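(* Let $(G,\precsim)$ be a C-quasi-ordered group. There exists a valuation $v$ on $G$ with value set $\Gamma\cup\{\infty\}$, called the type-valuation associated to $\precsim$, such that the following holds: (i) For any $\gamma\in\Gamma$, $G^{\gamma}=\{g\in G\mid v(g)\geq\gamma\}$ and $G_{\gamma}=\{g\in G\mid v(g)>\gamma\}$ are $\precsim$-strictly convex subgroups of $G$. (ii) The quasi-order $\precsim_{\gamma}$ induced by $\precsim$ on $H_{\gamma}:=G^{\gamma}/G_{\gamma}$ is of elementary type. (iii) If $\gamma<\delta$ are elements of $\Gamma$ such that $\precsim_{\gamma}$ and $\precsim_{\delta}$ are both valuational, then there exists $\alpha$ between $\gamma$ and $\delta$ such that $\precsim_{\alpha}$ is order-type. Moreover, the quasi-order $\precsim$ can be obtained by lifting the family $(\precsim_{\gamma})_{\gamma\in\Gamma}$ to $G$ and then welding if necessary.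
   Context: Quasi-orders. A quasi-order is a reflexive, transitive and total binary relation $\precsim$; $a\sim b$ means $a\precsim b\precsim a$, $cl(a)$ is the $\sim$-class of $a$, and $a\precnsim b$ means $a\precsim b$ and $a\nsim b$. For subsets, $S\precsim T$ (resp. $S\precnsim T$) means $s\precsim t$ (resp. $s\precnsim t$) for all $s\in S$, $t\in T$ (a single element stands for its singleton). An element $c$ is between $a$ and $b$ if $a\precsim c\precsim b$ or $b\precsim c\precsim a$. $\max(S)=\{s\in S\mid t\precsim s\ \forall t\in S\}$. $S$ is strictly convex if $s,t\in S$ and $s\precnsim a\precnsim t$ imply $a\in S$. A coarsening of $\precsim$ is a quasi-order $\precsim_2$ such that $a\precsim b$ implies $a\precsim_2 b$. C-relations. A C-relation on a set is a ternary relation $C$ such that for all $x,y,z,w$: $C(x,y,z)\Rightarrow C(x,z,y)$; $C(x,y,z)\Rightarrow\neg C(y,x,z)$; $C(x,y,z)\Rightarrow C(w,y,z)\vee C(x,w,z)$; $x\neq y\Rightarrow C(x,y,y)$. On a group it is compatible if $C(x,y,z)$ implies $C(vxu,vyu,vzu)$ for all $x,y,z,u,v$. A C-quasi-order (C-q.o.) on a group $G$ is a quasi-order of the form $x\precsim y\Leftrightarrow\neg C(x,y,1)$ with $C$ a compatible C-relation (which is then unique: $C(x,y,z)\Leftrightarrow yz^{-1}\precnsim xz^{-1}$). A C-quasi-ordered group is a group with a C-q.o. Valuations. With $g^z:=zgz^{-1}$, a valuation on a group $G$ is a map $v:G\to\Gamma\cup\{\infty\}$, $\Gamma$ totally ordered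 and $\gamma<\infty$ for all $\gamma\in\Gamma$, such that $v(g)=\infty\Leftrightarrow g=1$; $v(gh^{-1})\geq\min(v(g),v(h))$; $v(g)\leq v(h)\Leftrightarrow v(g^z)\leq v(h^z)$. For every $\gamma\in\Gamma$, $G_\gamma$ is a normal subgroup of $G^\gamma$. Elementary type. A C-q.o. is order-type if its C-relation is $C(x,y,z)\Leftrightarrow(y<x\wedge z<x)\vee(y=z\neq x)$ for some total order on $G$ that is invariant under left and right multiplication; it is valuational if its C-relation is $C(x,y,z)\Leftrightarrow v(yz^{-1})>v(xz^{-1})$ for some valuation $v$ on $G$ (equivalently $g\precsim h\Leftrightarrow v(g)\geq v(h)$). It is of elementary type if it is order-type or valuational. Types and type-components. In a quasi-ordered group, $g$ is v-type if $g\sim g^{-1}$; o-type if $g=1$ or $g\nsim g^{-1}$; $o^+$-type if $g^{-1}\precnsim g$; $o^-$-type if $g\precnsim g^{-1}$. For $g\neq 1$ in $(G,\precsim)$, the type-component $T_g$ is: if $g$ is v-type, the set of v-type elements $h\neq1$ such that there is no $o^+$-type element between $h$ and $g$; if $g$ is $o^+$-type, $T_g:=T_g^+\cup T_g^-$ where $T_g^+$ is the set of $o^+$-type elements $h$ such that every element between $g$ and $h$ is $o^+$-type and $T_g^-:=(T_g^+)^{-1}$; if $g$ is $o^-$-type, $T_g:=T_{g^{-1}}$. Put $T_1:=\{1\}$. Type-valuation. The set of type-components is totally ordered by $T_g\leq T_h\Leftrightarrow(T_g=T_h$ or $T_g\precsim T_h)$. Let $\leq^{\ast}$ be the reverse order.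 The type-valuation is $v(g):=T_g$, with values in the set of type-components ordered by $\leq^{\ast}$, where $T_1$ plays the role of $\infty$. Induced quasi-order. If $H$ is a strictly convex normal subgroup of a C-quasi-ordered group $(K,\precsim)$, the induced C-q.o. on $K/H$ is $gH\precsim hH\Leftrightarrow g\in H\vee(h\notin H\wedge g\precsim h)$. In (ii) take $K=G^\gamma$, $H=G_\gamma$. Lifting. Given a valuation $v:G\to\Gamma\cup\{\infty\}$ and quasi-orders $\precsim_\gamma$ on $G^\gamma/G_\gamma$ for $\gamma\in\Gamma$, the lifting of $(\precsim_\gamma)_{\gamma\in\Gamma}$ to $G$ is the quasi-order given by $g\precsim h\Leftrightarrow v(g)>v(h)\vee(v(g)=v(h)=\gamma\wedge gG_\gamma\precsim_\gamma hG_\gamma)$ (with $1\precsim 1$). Welding. Let $(G,\precsim)$ be a C-quasi-ordered group and let $g\in G$ be an $o^-$-type element. Put $G_g:=\{h\mid \{h,h^{-1}\}\precsim g\}$ and $M_g:=\max(G_g)$, and suppose $M_g\neq\varnothing$. Then for every $z\in G$ the element $g^z$ is $o^-$-type and $M_{g^z}=\max(G_{g^z})$ is non-empty, and no element lies strictly between $M_{g^z}$ and $cl(g^z)$. Welding is the operation of passing from $\precsim$ to the coarsening $\precsim_2$ of $\precsim$ obtained by declaring $M_{g^z}\sim_2 g^z$ for every $z\in G$, i.e. by joining the sets $M_{g^z}$ and $cl(g^z)$ into one equivalence class for each $z\in G$ and changing nothing else; $\precsim_2$ is again a C-q.o. *)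

theory Defs
  imports "HOL-Algebra.Algebra"
begin

definition quasi_order_on :: "'a set \<Rightarrow> ('a \<Rightarrow> 'a \<Rightarrow> bool) \<Rightarrow> bool" where
  "quasi_order_on S q \<longleftrightarrow> reflp_on S q \<and> transp_on S q \<and> totalp_on S q"

definition total_order_on :: "'a set \<Rightarrow> ('a \<Rightarrow> 'a \<Rightarrow> bool) \<Rightarrow> bool" where
  "total_order_on S leq \<longleftrightarrow> quasi_order_on S leq \<and> antisymp_on S leq"

definition qsim :: "('a \<Rightarrow> 'a \<Rightarrow> bool) \<Rightarrow> 'a \<Rightarrow> 'a \<Rightarrow> bool" where
  "qsim q a b \<longleftrightarrow> q a b \<and> q b a"

definition qless :: "('a \<Rightarrow> 'a \<Rightarrow> bool) \<Rightarrow> 'a \<Rightarrow> 'a \<Rightarrow> bool" where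
  "qless q a b \<longleftrightarrow> q a b \<and> \<not> qsim q a b"

definition set_le :: "('a \<Rightarrow> 'a \<Rightarrow> bool) \<Rightarrow> 'a set \<Rightarrow> 'a set \<Rightarrow> bool" where
  "set_le q S T \<longleftrightarrow> (\<forall>s\<in>S. \<forall>t\<in>T. q s t)"

definition between :: "('a \<Rightarrow> 'a \<Rightarrow> bool) \<Rightarrow> 'a \<Rightarrow> 'a \<Rightarrow> 'a \<Rightarrow> bool" where
  "between q a b c \<longleftrightarrow> (q a c \<and> q c b) \<or> (q b c \<and> q c a)"

definition qmax :: "('a \<Rightarrow> 'a \<Rightarrow> bool) \<Rightarrow> 'a set \<Rightarrow> 'a set" where
  "qmax q S = {s \<in> S. \<forall>t\<in>S. q t s}"

definition qclass :: "('a, 'm) monoid_scheme \<Rightarrow> ('a \<Rightarrow> 'a \<Rightarrow> bool) \<Rightarrow> 'a \<Rightarrow> 'a set" where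
  "qclass G q a = {b \<in> carrier G. qsim q a b}"

definition strictly_convex ::
  "('a, 'm) monoid_scheme \<Rightarrow> ('a \<Rightarrow> 'a \<Rightarrow> bool) \<Rightarrow> 'a set \<Rightarrow> bool" where
  "strictly_convex G q S \<longleftrightarrow> S \<subseteq> carrier G \<and>
     (\<forall>s\<in>S. \<forall>t\<in>S. \<forall>a\<in>carrier G. qless q s a \<and> qless q a t \<longrightarrow> a \<in> S)"

definition conj_by :: "('a, 'm) monoid_scheme \<Rightarrow> 'a \<Rightarrow> 'a \<Rightarrow> 'a" where
  "conj_by G z g = z \<otimes>\<^bsub>G\<^esub> g \<otimes>\<^bsub>G\<^esub> inv\<^bsub>G\<^esub> z"

definition c_relation_on :: "'a set \<Rightarrow> ('a \<Rightarrow> 'a \<Rightarrow> 'a \<Rightarrow> bool) \<Rightarrow> bool" where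
  "c_relation_on S C \<longleftrightarrow>
     (\<forall>x\<in>S. \<forall>y\<in>S. \<forall>z\<in>S. C x y z \<longrightarrow> C x z y) \<and>
     (\<forall>x\<in>S. \<forall>y\<in>S. \<forall>z\<in>S. C x y z \<longrightarrow> \<not> C y x z) \<and>
     (\<forall>x\<in>S. \<forall>y\<in>S. \<forall>z\<in>S. \<forall>w\<in>S. C x y z \<longrightarrow> C w y z \<or> C x w z) \<and>
     (\<forall>x\<in>S. \<forall>y\<in>S. x \<noteq> y \<longrightarrow> C x y y)"

definition compatible ::
  "('a, 'm) monoid_scheme \<Rightarrow> ('a \<Rightarrow> 'a \<Rightarrow> 'a \<Rightarrow> bool) \<Rightarrow> bool" where
  "compatible G C \<longleftrightarrow>
     (\<forall>x\<in>carrier G. \<forall>y\<in>carrier G. \<forall>z\<in>carrier G. \<forall>u\<in>carrier G. \<forall>v\<in>carrier G.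
        C x y z \<longrightarrow>
        C (v \<otimes>\<^bsub>G\<^esub> x \<otimes>\<^bsub>G\<^esub> u) (v \<otimes>\<^bsub>G\<^esub> y \<otimes>\<^bsub>G\<^esub> u) (v \<otimes>\<^bsub>G\<^esub> z \<otimes>\<^bsub>G\<^esub> u))"

definition c_relation_of ::
  "('a, 'm) monoid_scheme \<Rightarrow> ('a \<Rightarrow> 'a \<Rightarrow> bool) \<Rightarrow> ('a \<Rightarrow> 'a \<Rightarrow> 'a \<Rightarrow> bool) \<Rightarrow> bool" where
  "c_relation_of G q C \<longleftrightarrow> c_relation_on (carrier G) C \<and> compatible G C \<and>
     (\<forall>x\<in>carrier G. \<forall>y\<in>carrier G. q x y \<longleftrightarrow> \<not> C x y \<one>\<^bsub>G\<^esub>)"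

definition c_quasi_ordered_group ::
  "('a, 'm) monoid_scheme \<Rightarrow> ('a \<Rightarrow> 'a \<Rightarrow> bool) \<Rightarrow> bool" where
  "c_quasi_ordered_group G q \<longleftrightarrow>
     group G \<and> quasi_order_on (carrier G) q \<and> (\<exists>C. c_relation_of G q C)"

text \<open>The value set is given by \<open>\<Gamma>\<close>, a point \<open>infty\<close> outside \<open>\<Gamma>\<close>, and a relation \<open>leq\<close> which
  totally orders \<open>insert infty \<Gamma>\<close> with largest element \<open>infty\<close>.  The disjunction in the
  ultrametric condition says \<open>v (g h\<^sup>-\<^sup>1) \<ge> min (v g) (v h)\<close>.\<close>

definition valuation ::
  "('a, 'm) monoid_scheme \<Rightarrow> 'c set \<Rightarrow> ('c \<Rightarrow> 'c \<Rightarrow> bool) \<Rightarrow> 'c \<Rightarrow> ('a \<Rightarrow> 'c) \<Rightarrow> bool" where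
  "valuation G \<Gamma> leq infty v \<longleftrightarrow>
     infty \<notin> \<Gamma> \<and> total_order_on (insert infty \<Gamma>) leq \<and> (\<forall>\<gamma>\<in>\<Gamma>. qless leq \<gamma> infty) \<and>
     v \<in> carrier G \<rightarrow> insert infty \<Gamma> \<and>
     (\<forall>g\<in>carrier G. v g = infty \<longleftrightarrow> g = \<one>\<^bsub>G\<^esub>) \<and>
     (\<forall>g\<in>carrier G. \<forall>h\<in>carrier G.
        leq (v g) (v (g \<otimes>\<^bsub>G\<^esub> inv\<^bsub>G\<^esub> h)) \<or> leq (v h) (v (g \<otimes>\<^bsub>G\<^esub> inv\<^bsub>G\<^esub> h))) \<and>
     (\<forall>g\<in>carrier G. \<forall>h\<in>carrier G. \<forall>z\<in>carrier G.
        leq (v g) (v h) \<longleftrightarrow> leq (v (conj_by G z g)) (v (conj_by G z h)))"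

definition val_ge ::
  "('a, 'm) monoid_scheme \<Rightarrow> ('c \<Rightarrow> 'c \<Rightarrow> bool) \<Rightarrow> ('a \<Rightarrow> 'c) \<Rightarrow> 'c \<Rightarrow> 'a set" where
  "val_ge G leq v \<gamma> = {g \<in> carrier G. leq \<gamma> (v g)}"

definition val_gt ::
  "('a, 'm) monoid_scheme \<Rightarrow> ('c \<Rightarrow> 'c \<Rightarrow> bool) \<Rightarrow> ('a \<Rightarrow> 'c) \<Rightarrow> 'c \<Rightarrow> 'a set" where
  "val_gt G leq v \<gamma> = {g \<in> carrier G. qless leq \<gamma> (v g)}"

definition order_type :: "('a, 'm) monoid_scheme \<Rightarrow> ('a \<Rightarrow> 'a \<Rightarrow> bool) \<Rightarrow> bool" where
  "order_type G q \<longleftrightarrow> c_quasi_ordered_group G q \<and>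
     (\<exists>C leq. c_relation_of G q C \<and> total_order_on (carrier G) leq \<and>
        (\<forall>x\<in>carrier G. \<forall>y\<in>carrier G. \<forall>z\<in>carrier G. leq x y \<longrightarrow>
            leq (z \<otimes>\<^bsub>G\<^esub> x) (z \<otimes>\<^bsub>G\<^esub> y) \<and> leq (x \<otimes>\<^bsub>G\<^esub> z) (y \<otimes>\<^bsub>G\<^esub> z)) \<and>
        (\<forall>x\<in>carrier G. \<forall>y\<in>carrier G. \<forall>z\<in>carrier G.
            C x y z \<longleftrightarrow> (qless leq y x \<and> qless leq z x) \<or> (y = z \<and> z \<noteq> x)))"

text \<open>HOL cannot quantify existentially over the type of the value set.  Taking values in
  \<open>'a set\<close> is no restriction: only the value set cut down to the image of \<open>v\<close> together with the
  largest element matters, and each value \<open>v g\<close> can be replaced by the fibre of \<open>v\<close> over it.\<close>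

definition valuational :: "('a, 'm) monoid_scheme \<Rightarrow> ('a \<Rightarrow> 'a \<Rightarrow> bool) \<Rightarrow> bool" where
  "valuational G q \<longleftrightarrow> c_quasi_ordered_group G q \<and>
     (\<exists>C (\<Gamma> :: 'a set set) leq infty v. c_relation_of G q C \<and> valuation G \<Gamma> leq infty v \<and>
        (\<forall>x\<in>carrier G. \<forall>y\<in>carrier G. \<forall>z\<in>carrier G.
            C x y z \<longleftrightarrow> qless leq (v (x \<otimes>\<^bsub>G\<^esub> inv\<^bsub>G\<^esub> z)) (v (y \<otimes>\<^bsub>G\<^esub> inv\<^bsub>G\<^esub> z))))"

definition elementary_type :: "('a, 'm) monoid_scheme \<Rightarrow> ('a \<Rightarrow> 'a \<Rightarrow> bool) \<Rightarrow> bool" where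
  "elementary_type G q \<longleftrightarrow> order_type G q \<or> valuational G q"

definition v_type :: "('a, 'm) monoid_scheme \<Rightarrow> ('a \<Rightarrow> 'a \<Rightarrow> bool) \<Rightarrow> 'a \<Rightarrow> bool" where
  "v_type G q g \<longleftrightarrow> qsim q g (inv\<^bsub>G\<^esub> g)"

definition o_plus :: "('a, 'm) monoid_scheme \<Rightarrow> ('a \<Rightarrow> 'a \<Rightarrow> bool) \<Rightarrow> 'a \<Rightarrow> bool" where
  "o_plus G q g \<longleftrightarrow> qless q (inv\<^bsub>G\<^esub> g) g"

definition o_minus :: "('a, 'm) monoid_scheme \<Rightarrow> ('a \<Rightarrow> 'a \<Rightarrow> bool) \<Rightarrow> 'a \<Rightarrow> bool" where
  "o_minus G q g \<longleftrightarrow> qless q g (inv\<^bsub>G\<^esub> g)"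

definition v_component :: "('a, 'm) monoid_scheme \<Rightarrow> ('a \<Rightarrow> 'a \<Rightarrow> bool) \<Rightarrow> 'a \<Rightarrow> 'a set" where
  "v_component G q g = {h \<in> carrier G. h \<noteq> \<one>\<^bsub>G\<^esub> \<and> v_type G q h \<and>
     \<not> (\<exists>k\<in>carrier G. o_plus G q k \<and> between q h g k)}"

definition o_plus_part :: "('a, 'm) monoid_scheme \<Rightarrow> ('a \<Rightarrow> 'a \<Rightarrow> bool) \<Rightarrow> 'a \<Rightarrow> 'a set" where
  "o_plus_part G q g = {h \<in> carrier G. o_plus G q h \<and>
     (\<forall>k\<in>carrier G. between q g h k \<longrightarrow> o_plus G q k)}"

definition o_component :: "('a, 'm) monoid_scheme \<Rightarrow> ('a \<Rightarrow> 'a \<Rightarrow> bool) \<Rightarrow> 'a \<Rightarrow> 'a set" where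
  "o_component G q g = o_plus_part G q g \<union> (\<lambda>h. inv\<^bsub>G\<^esub> h) ` o_plus_part G q g"

definition type_component :: "('a, 'm) monoid_scheme \<Rightarrow> ('a \<Rightarrow> 'a \<Rightarrow> bool) \<Rightarrow> 'a \<Rightarrow> 'a set" where
  "type_component G q g =
     (if g = \<one>\<^bsub>G\<^esub> then {\<one>\<^bsub>G\<^esub>}
      else if v_type G q g then v_component G q g
      else if o_plus G q g then o_component G q g
      else o_component G q (inv\<^bsub>G\<^esub> g))"

definition type_values :: "('a, 'm) monoid_scheme \<Rightarrow> ('a \<Rightarrow> 'a \<Rightarrow> bool) \<Rightarrow> 'a set set" where
  "type_values G q = type_component G q ` (carrier G - {\<one>\<^bsub>G\<^esub>})"

definition type_le :: "('a \<Rightarrow> 'a \<Rightarrow> bool) \<Rightarrow> 'a set \<Rightarrow> 'a set \<Rightarrow> bool" where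
  "type_le q S T \<longleftrightarrow> S = T \<or> set_le q S T"

definition type_le_rev :: "('a \<Rightarrow> 'a \<Rightarrow> bool) \<Rightarrow> 'a set \<Rightarrow> 'a set \<Rightarrow> bool" where
  "type_le_rev q S T \<longleftrightarrow> type_le q T S"

text \<open>The relation on cosets is given through some representatives; whether it is independent of
  their choice is a matter of proof.\<close>

definition induced_qo ::
  "'a set \<Rightarrow> ('a \<Rightarrow> 'a \<Rightarrow> bool) \<Rightarrow> 'a set \<Rightarrow> 'a set \<Rightarrow> bool" where
  "induced_qo H q A B \<longleftrightarrow> (\<exists>g\<in>A. \<exists>h\<in>B. g \<in> H \<or> (h \<notin> H \<and> q g h))"

definition lifted_qo ::
  "('a, 'm) monoid_scheme \<Rightarrow> 'c set \<Rightarrow> ('c \<Rightarrow> 'c \<Rightarrow> bool) \<Rightarrow> ('a \<Rightarrow> 'c) \<Rightarrow>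
   ('c \<Rightarrow> 'a set \<Rightarrow> 'a set \<Rightarrow> bool) \<Rightarrow> 'a \<Rightarrow> 'a \<Rightarrow> bool" where
  "lifted_qo G \<Gamma> leq v Q g h \<longleftrightarrow>
     qless leq (v h) (v g) \<or>
     (\<exists>\<gamma>\<in>\<Gamma>. v g = \<gamma> \<and> v h = \<gamma> \<and>
        Q \<gamma> (val_gt G leq v \<gamma> #>\<^bsub>G\<^esub> g) (val_gt G leq v \<gamma> #>\<^bsub>G\<^esub> h)) \<or>
     (g = \<one>\<^bsub>G\<^esub> \<and> h = \<one>\<^bsub>G\<^esub>)"

definition weld_max :: "('a, 'm) monoid_scheme \<Rightarrow> ('a \<Rightarrow> 'a \<Rightarrow> bool) \<Rightarrow> 'a \<Rightarrow> 'a set" where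
  "weld_max G q g = qmax q {h \<in> carrier G. q h g \<and> q (inv\<^bsub>G\<^esub> h) g}"

text \<open>Welding at all elements of \<open>W\<close> simultaneously: the smallest transitive relation containing
  \<open>q\<close> in which, for all \<open>g \<in> W\<close> and \<open>z \<in> G\<close>, any two elements of the union of \<open>weld_max G q g\<^sup>z\<close>
  and the class of \<open>g\<^sup>z\<close> are equivalent.  A single welding is the case of a singleton \<open>W\<close>; for
  empty \<open>W\<close> nothing changes.\<close>

definition weld ::
  "('a, 'm) monoid_scheme \<Rightarrow> ('a \<Rightarrow> 'a \<Rightarrow> bool) \<Rightarrow> 'a set \<Rightarrow> 'a \<Rightarrow> 'a \<Rightarrow> bool" where
  "weld G q W = tranclp (\<lambda>x y. x \<in> carrier G \<and> y \<in> carrier G \<and>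
     (q x y \<or>
      (\<exists>g\<in>W. \<exists>z\<in>carrier G.
         x \<in> weld_max G q (conj_by G z g) \<union> qclass G q (conj_by G z g) \<and>
         y \<in> weld_max G q (conj_by G z g) \<union> qclass G q (conj_by G z g))))"

definition weldable :: "('a, 'm) monoid_scheme \<Rightarrow> ('a \<Rightarrow> 'a \<Rightarrow> bool) \<Rightarrow> 'a \<Rightarrow> bool" where
  "weldable G q g \<longleftrightarrow> g \<in> carrier G \<and> o_minus G q g \<and> weld_max G q g \<noteq> {}"

end

theory Submission
  imports Defs
begin

text \<open>The key observation is that if \<open>g \<noteq> 1\<close> is not \<open>o\<^sup>+\<close>-type, then \<open>{x. x \<preceq> g \<and> x\<^sup>-\<^sup>1 \<preceq> g}\<close> is a
  subgroup, and so is the set of all elements strictly below \<open>g\<close>; in particular an \<open>o\<^sup>+\<close>-type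
  element is never equivalent to one of another type.  Replacing each \<open>x\<close> by its crest, the larger
  of \<open>x\<close> and \<open>x\<^sup>-\<^sup>1\<close>, the type-components become the maximal \<open>\<preceq>\<close>-convex sets of crests of
  constant type.  Between the crests of different components lies an element that is not
  \<open>o\<^sup>+\<close>-type, and the subgroup it cuts out gives the ultrametric inequality.  If \<open>x\<close> has strictly
  larger value than \<open>y\<close>, then \<open>x \<preceq> y\<close> and \<open>x y\<close> is equivalent to \<open>y\<close>, so \<open>\<preceq>\<close> descends to the
  quotients, where either all non-trivial elements are v-type, or the \<open>o\<^sup>+\<close>-type elements form the
  positive cone of an order.  The lifting is the lexicographic refinement of \<open>\<preceq>\<close> by the value; it
  differs from \<open>\<preceq>\<close> only where an \<open>o\<^sup>-\<close>-type \<open>x\<close> is \<open>\<preceq>\<close>-equivalent to a v-type \<open>y\<close> of larger value,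
  and then \<open>y\<close> lies in \<open>M\<^sub>x\<close>, so that welding at \<open>x\<close> identifies the two.\<close>

section \<open>Compatible C-relations as translation rules for the quasi-order\<close>

text \<open>This form does without a C-relation. With \<open>\<not> b \<preceq> a\<close> read as
  C(b,a,1), \<open>shift\<close> is the symmetry C(b,a,1) \<Longrightarrow> C(b,1,a) followed by
  right translation with \<open>inv a\<close>, \<open>q_one\<close> is the axiom C(x,y,y) at y =
  \<open>\<one>\<close>, and \<open>conj_less\<close> is compatibility.\<close>

locale cqo_group = group G for G :: "('a, 'm) monoid_scheme" (structure) +
  fixes q :: "'a \<Rightarrow> 'a \<Rightarrow> bool" (infix "\<preceq>" 50)
  assumes q_refl: "x \<in> carrier G \<Longrightarrow> x \<preceq> x"
    and q_trans: "\<lbrakk>x \<in> carrier G; y \<in> carrier G; z \<in> carrier G; x \<preceq> y; y \<preceq> z\<rbrakk> \<Longrightarrow> x \<preceq> z"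
    and q_total: "\<lbrakk>x \<in> carrier G; y \<in> carrier G\<rbrakk> \<Longrightarrow> x \<preceq> y \<or> y \<preceq> x"
    and q_one: "\<lbrakk>x \<in> carrier G; x \<preceq> \<one>\<rbrakk> \<Longrightarrow> x = \<one>"
    and shift: "\<lbrakk>a \<in> carrier G; b \<in> carrier G; \<not> b \<preceq> a\<rbrakk> \<Longrightarrow> \<not> b \<otimes> inv a \<preceq> inv a"
    and conj_less: "\<lbrakk>a \<in> carrier G; b \<in> carrier G; z \<in> carrier G; \<not> b \<preceq> a\<rbrakk>
      \<Longrightarrow> \<not> conj_by G z b \<preceq> conj_by G z a"

text \<open>Right translation by the inverse of \<open>z\<close> moves the third argument to the
  identity, and right translation by \<open>z\<close> moves it back.\<close>

lemma c_relation_of_iff: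
  assumes "c_relation_of G q C" "group G" "quasi_order_on (carrier G) q"
    and xyz: "x \<in> carrier G" "y \<in> carrier G" "z \<in> carrier G"
  shows "C x y z \<longleftrightarrow> \<not> q (x \<otimes>\<^bsub>G\<^esub> inv\<^bsub>G\<^esub> z) (y \<otimes>\<^bsub>G\<^esub> inv\<^bsub>G\<^esub> z)"
proof -
  interpret group G by fact
  have comp: "C (v \<otimes>\<^bsub>G\<^esub> a \<otimes>\<^bsub>G\<^esub> u) (v \<otimes>\<^bsub>G\<^esub> b \<otimes>\<^bsub>G\<^esub> u) (v \<otimes>\<^bsub>G\<^esub> c \<otimes>\<^bsub>G\<^esub> u)"
    if "C a b c" "a \<in> carrier G" "b \<in> carrier G" "c \<in> carrier G" "u \<in> carrier G" "v \<in> carrier G"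
    for a b c u v
    using assms(1) that unfolding c_relation_of_def compatible_def by blast
  have "C x y z \<longleftrightarrow> C (x \<otimes>\<^bsub>G\<^esub> inv\<^bsub>G\<^esub> z) (y \<otimes>\<^bsub>G\<^esub> inv\<^bsub>G\<^esub> z) \<one>\<^bsub>G\<^esub>"
    using comp[of x y z "inv\<^bsub>G\<^esub> z" "\<one>\<^bsub>G\<^esub>"] xyz
      comp[of "x \<otimes>\<^bsub>G\<^esub> inv\<^bsub>G\<^esub> z" "y \<otimes>\<^bsub>G\<^esub> inv\<^bsub>G\<^esub> z" "\<one>\<^bsub>G\<^esub>" z "\<one>\<^bsub>G\<^esub>"]
    by (auto simp: m_assoc)
  moreover have "q a b \<longleftrightarrow> \<not> C a b \<one>\<^bsub>G\<^esub>" if "a \<in> carrier G" "b \<in> carrier G" for a b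
    using assms(1) that unfolding c_relation_of_def by blast
  ultimately show ?thesis using xyz by simp
qed

lemma cqo_group_if_c_quasi_ordered_group:
  assumes "c_quasi_ordered_group G q"
  shows "cqo_group G q"
proof -
  from assms obtain C where gr: "group G" and qo: "quasi_order_on (carrier G) q"
    and C: "c_relation_of G q C"
    unfolding c_quasi_ordered_group_def by blast
  interpret group G by fact
  note iff = c_relation_of_iff[OF C gr qo]
  have Crel: "c_relation_on (carrier G) C"
    using C unfolding c_relation_of_def by blast
  have swap: "C x z y" if "C x y z" "x \<in> carrier G" "y \<in> carrier G" "z \<in> carrier G" for x y z
  proof -
    have "\<forall>x\<in>carrier G. \<forall>y\<in>carrier G. \<forall>z\<in>carrier G. C x y z \<longrightarrow> C x z y"
      using Crel unfolding c_relation_on_def by (rule conjunct1)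
    then show ?thesis using that by blast
  qed
  have diag: "\<forall>x\<in>carrier G. \<forall>y\<in>carrier G. x \<noteq> y \<longrightarrow> C x y y"
    using Crel unfolding c_relation_on_def by (elim conjE)
  have comp: "C (v \<otimes>\<^bsub>G\<^esub> a \<otimes>\<^bsub>G\<^esub> u) (v \<otimes>\<^bsub>G\<^esub> b \<otimes>\<^bsub>G\<^esub> u) (v \<otimes>\<^bsub>G\<^esub> c \<otimes>\<^bsub>G\<^esub> u)"
    if "C a b c" "a \<in> carrier G" "b \<in> carrier G" "c \<in> carrier G" "u \<in> carrier G" "v \<in> carrier G"
    for a b c u v
    using C that unfolding c_relation_of_def compatible_def by blast
  show ?thesis
  proof
    fix x assume "x \<in> carrier G" then show "q x x"
      using qo unfolding quasi_order_on_def reflp_on_def by blast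
  next
    fix x y z assume "x \<in> carrier G" "y \<in> carrier G" "z \<in> carrier G" "q x y" "q y z"
    then show "q x z"
      using qo unfolding quasi_order_on_def transp_on_def by blast
  next
    fix x y assume "x \<in> carrier G" "y \<in> carrier G"
    then show "q x y \<or> q y x"
      using qo totalp_onD[of "carrier G" q x y] reflp_onD[of "carrier G" q x]
      unfolding quasi_order_on_def by (cases "x = y") simp_all
  next
    fix x assume x: "x \<in> carrier G" "q x \<one>\<^bsub>G\<^esub>"
    have "C x \<one>\<^bsub>G\<^esub> \<one>\<^bsub>G\<^esub>" if "x \<noteq> \<one>\<^bsub>G\<^esub>"
      using diag x that by blast
    then show "x = \<one>\<^bsub>G\<^esub>" using iff[of x "\<one>\<^bsub>G\<^esub>" "\<one>\<^bsub>G\<^esub>"] x by auto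
  next
    fix a b assume ab: "a \<in> carrier G" "b \<in> carrier G" "\<not> q b a"
    then have "C b a \<one>\<^bsub>G\<^esub>" using iff[of b a "\<one>\<^bsub>G\<^esub>"] by auto
    then have "C b \<one>\<^bsub>G\<^esub> a" using swap[of b a "\<one>\<^bsub>G\<^esub>"] ab by blast
    then show "\<not> q (b \<otimes>\<^bsub>G\<^esub> inv\<^bsub>G\<^esub> a) (inv\<^bsub>G\<^esub> a)" using iff[of b "\<one>\<^bsub>G\<^esub>" a] ab by auto
  next
    fix a b z assume ab: "a \<in> carrier G" "b \<in> carrier G" "z \<in> carrier G" "\<not> q b a"
    then have "C b a \<one>\<^bsub>G\<^esub>" using iff[of b a "\<one>\<^bsub>G\<^esub>"] by auto
    then have "C (conj_by G z b) (conj_by G z a) \<one>\<^bsub>G\<^esub>"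
      using comp[of b a "\<one>\<^bsub>G\<^esub>" "inv\<^bsub>G\<^esub> z" z] ab by (auto simp: conj_by_def)
    then show "\<not> q (conj_by G z b) (conj_by G z a)"
      using iff[of "conj_by G z b" "conj_by G z a" "\<one>\<^bsub>G\<^esub>"] ab by (auto simp: conj_by_def)
  qed
qed

section \<open>Subgroups cut out by elements that are not o^+-type\<close>

context cqo_group
begin

text \<open>On \<open>carrier G\<close>, where \<open>\<preceq>\<close> is total, this is the strict part of \<open>\<preceq>\<close>.\<close>

abbreviation below :: "'a \<Rightarrow> 'a \<Rightarrow> bool" (infix "\<lless>" 50) where
  "x \<lless> y \<equiv> \<not> y \<preceq> x"

lemma inv_mult_cancel [simp]:
  assumes "x \<in> carrier G" "y \<in> carrier G"
  shows "x \<otimes> (inv x \<otimes> y) = y" "inv x \<otimes> (x \<otimes> y) = y"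
  using assms by (simp_all add: m_assoc[symmetric])

lemma qless_iff:
  assumes "x \<in> carrier G" "y \<in> carrier G"
  shows "qless q x y \<longleftrightarrow> x \<lless> y"
  using assms q_total unfolding qless_def qsim_def by blast

lemma q_le_if_below: "\<lbrakk>x \<in> carrier G; y \<in> carrier G; x \<lless> y\<rbrakk> \<Longrightarrow> x \<preceq> y"
  using q_total by blast

lemma below_q_trans:
  "\<lbrakk>x \<in> carrier G; y \<in> carrier G; z \<in> carrier G; x \<lless> y; y \<preceq> z\<rbrakk> \<Longrightarrow> x \<lless> z"
  using q_trans by blast

lemma q_below_trans:
  "\<lbrakk>x \<in> carrier G; y \<in> carrier G; z \<in> carrier G; x \<preceq> y; y \<lless> z\<rbrakk> \<Longrightarrow> x \<lless> z"
  using q_trans by blast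

lemma one_least: "x \<in> carrier G \<Longrightarrow> \<one> \<preceq> x"
  using q_one q_total q_refl by blast

lemma conj_by_closed [simp]:
  "\<lbrakk>z \<in> carrier G; x \<in> carrier G\<rbrakk> \<Longrightarrow> conj_by G z x \<in> carrier G"
  by (simp add: conj_by_def)

lemma inv_conj_by [simp]:
  "\<lbrakk>z \<in> carrier G; x \<in> carrier G\<rbrakk> \<Longrightarrow> inv (conj_by G z x) = conj_by G z (inv x)"
  by (simp add: conj_by_def m_assoc inv_mult_group)

lemma conj_by_inv_cancel [simp]:
  assumes "z \<in> carrier G" "x \<in> carrier G"
  shows "conj_by G (inv z) (conj_by G z x) = x" "conj_by G z (conj_by G (inv z) x) = x"
  using assms by (simp_all add: conj_by_def m_assoc)

lemma conj_q_iff [simp]: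
  assumes "z \<in> carrier G" "x \<in> carrier G" "y \<in> carrier G"
  shows "conj_by G z x \<preceq> conj_by G z y \<longleftrightarrow> x \<preceq> y"
proof
  show "x \<preceq> y" if "conj_by G z x \<preceq> conj_by G z y"
    using conj_less[of y x z] assms that by blast
  show "conj_by G z x \<preceq> conj_by G z y" if "x \<preceq> y"
    using conj_less[of "conj_by G z y" "conj_by G z x" "inv z"] assms that by auto
qed

lemma conj_by_eq_one_iff [simp]:
  "\<lbrakk>z \<in> carrier G; x \<in> carrier G\<rbrakk> \<Longrightarrow> conj_by G z x = \<one> \<longleftrightarrow> x = \<one>"
  using conj_by_inv_cancel(1)[of z x] by (auto simp: conj_by_def)

text \<open>The left-handed form of \<open>shift\<close>, obtained by conjugating it with
  \<open>inv a\<close>.\<close>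

lemma shift_left:
  assumes "a \<in> carrier G" "b \<in> carrier G" "a \<lless> b"
  shows "inv a \<lless> inv a \<otimes> b"
proof -
  have "conj_by G (inv a) (inv a) \<lless> conj_by G (inv a) (b \<otimes> inv a)"
    using shift[OF assms] assms by simp
  then show ?thesis using assms by (simp add: conj_by_def m_assoc)
qed

lemma unshift:
  assumes "a \<in> carrier G" "b \<in> carrier G" "a \<lless> b \<otimes> a"
  shows "inv a \<lless> b"
  using shift[of a "b \<otimes> a"] assms by (simp add: m_assoc)

text \<open>In terms of C this is transitivity in the last two places: C(t,u,1) and C(t,w,1) give
  C(t,u,w).\<close>

lemma shift_both:
  assumes "u \<in> carrier G" "w \<in> carrier G" "t \<in> carrier G" "u \<lless> t" "w \<lless> t"
  shows "u \<otimes> inv w \<lless> t \<otimes> inv w"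
proof -
  \<comment> \<open>C(t,1,a) yields C(b,1,a) or C(t,b,a) for every \<open>b\<close>; by symmetry
    these are the two alternatives.\<close>
  have *: "a \<lless> b \<or> a \<otimes> inv b \<lless> t \<otimes> inv b"
    if ab: "a \<in> carrier G" "b \<in> carrier G" "a \<lless> t" for a b
  proof -
    have "inv a \<lless> t \<otimes> inv a" using shift that assms by blast
    then consider "inv a \<lless> b \<otimes> inv a" | "b \<otimes> inv a \<lless> t \<otimes> inv a"
      using q_trans[of "t \<otimes> inv a" "b \<otimes> inv a" "inv a"] ab assms by auto
    then show ?thesis
    proof cases
      case 1
      then show ?thesis using unshift[of "inv a" b] that by simp
    next
      case 2
      then show ?thesis
        using shift[of "b \<otimes> inv a" "t \<otimes> inv a"] that assms by (simp add: m_assoc inv_mult_group)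
    qed
  qed
  show ?thesis
  proof (rule ccontr)
    assume not: "\<not> ?thesis"
    \<comment> \<open>\<open>u \<lless> w\<close> excludes the first alternative when
      \<open>u\<close> and \<open>w\<close> are exchanged, so C(t,w,u) holds, which is C(t,u,w) by
      symmetry.\<close>
    then have "u \<lless> w" using *[of u w] assms by blast
    then have "w \<otimes> inv u \<lless> t \<otimes> inv u" using *[of w u] assms q_total by blast
    then show False
      using not shift[of "w \<otimes> inv u" "t \<otimes> inv u"] assms by (simp add: m_assoc inv_mult_group)
  qed
qed

text \<open>Suppose \<open>g \<preceq> inv a\<close>.  Then \<open>inv g \<lless> inv a\<close>, and translating by \<open>a\<close> gives \<open>C(1, a, inv g)\<close>
  for the C-relation of \<open>\<preceq>\<close>; but \<open>a \<lless> inv g\<close> says \<open>C(inv g, a, 1)\<close>.\<close>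

lemma inv_below:
  assumes g: "g \<in> carrier G" and a: "a \<in> carrier G"
    and N: "g \<preceq> inv g" and ag: "a \<lless> g"
  shows "inv a \<lless> g"
proof (rule ccontr)
  assume "\<not> inv a \<lless> g"
  then have "g \<preceq> inv a" by blast
  moreover have "inv a \<lless> inv a \<otimes> g" using shift_left ag a g by blast
  ultimately have "g \<lless> inv a \<otimes> g" using q_trans[of "inv a \<otimes> g" g "inv a"] a g by auto
  then have ga: "inv g \<lless> inv a" using unshift a g by blast
  have "conj_by G a (inv g) \<lless> conj_by G a (inv a)" using ga a g by simp
  then have "a \<otimes> inv g \<otimes> inv a \<lless> inv a" using a g by (simp add: conj_by_def)
  then have "a \<otimes> g \<otimes> inv a \<lless> g \<otimes> inv a"
    using shift[of "a \<otimes> inv g \<otimes> inv a" "inv a"] a g by (simp add: m_assoc inv_mult_group)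
  moreover have "inv a \<lless> g \<otimes> inv a" using shift ag a g by blast
  ultimately have "a \<otimes> g \<otimes> inv a \<otimes> inv (inv a) \<lless> g \<otimes> inv a \<otimes> inv (inv a)"
    using shift_both[of "a \<otimes> g \<otimes> inv a" "inv a" "g \<otimes> inv a"] a g by blast
  then have "a \<otimes> g \<lless> g" using a g by (simp add: m_assoc)
  \<comment> \<open>Translated on the right by \<open>a\<close> this reads C(1, inv g, a), and the
    next claim reads C(inv g, 1, a); the two exclude each other.\<close>
  then have "inv g \<otimes> inv a \<lless> inv a"
    using shift[of "a \<otimes> g" g] a g by (simp add: m_assoc inv_mult_group)
  moreover have "inv a \<lless> inv g \<otimes> inv a"
    using shift[of a "inv g"] below_q_trans[of a g "inv g"] N ag a g by simp
  ultimately show False using q_total[of "inv a" "inv g \<otimes> inv a"] a g by simp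
qed

text \<open>Right translation by \<open>inv k\<close> keeps \<open>h\<close> below \<open>g\<close>
  by \<open>shift_both\<close>. It does not raise \<open>g\<close>, since otherwise conjugation by
  \<open>inv g\<close> would give \<open>inv g \<lless> inv k\<close>, contrary to
  \<open>inv_below\<close>.\<close>

lemma div_below:
  assumes g: "g \<in> carrier G" and hk: "h \<in> carrier G" "k \<in> carrier G"
    and N: "g \<preceq> inv g" and "h \<lless> g" "k \<lless> g"
  shows "h \<otimes> inv k \<lless> g"
proof -
  have "g \<otimes> inv k \<preceq> g"
  proof (rule ccontr)
    assume "\<not> ?thesis"
    then have "inv g \<lless> g \<otimes> inv k \<otimes> inv g"
      using shift[of g "g \<otimes> inv k"] g hk by simp
    then have "conj_by G (inv g) (inv g) \<lless> conj_by G (inv g) (g \<otimes> inv k \<otimes> inv g)"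
      using g hk by simp
    then have "inv g \<lless> inv k" using g hk by (simp add: conj_by_def m_assoc)
    then have "g \<lless> inv k" using q_below_trans[of g "inv g" "inv k"] N g hk by simp
    moreover have "inv k \<lless> g" using inv_below assms by blast
    ultimately show False using q_total[of g "inv k"] g hk by simp
  qed
  then show ?thesis
    using shift_both[of h k g] below_q_trans[of "h \<otimes> inv k" "g \<otimes> inv k" g] assms by simp
qed

text \<open>Were the quotient \<open>x\<close> strictly above \<open>g\<close>, it would be strictly
  above \<open>h\<close> and \<open>k\<close>. Then either \<open>div_below\<close> with threshold
  \<open>x\<close> gives \<open>x \<lless> x\<close>, or translation and conjugation yield
  \<open>inv x \<lless> inv k\<close>, so that \<open>inv x\<close> and by \<open>inv_below\<close>
  also \<open>x\<close> lie below \<open>g\<close>.\<close>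

lemma div_le:
  assumes g: "g \<in> carrier G" and hk: "h \<in> carrier G" "k \<in> carrier G"
    and N: "g \<preceq> inv g" and h: "h \<preceq> g" "inv h \<preceq> g" and k: "k \<preceq> g" "inv k \<preceq> g"
  shows "h \<otimes> inv k \<preceq> g"
proof (rule ccontr)
  define x where "x = h \<otimes> inv k"
  have x: "x \<in> carrier G" using hk by (simp add: x_def)
  assume "\<not> ?thesis"
  then have gx: "g \<lless> x" by (simp add: x_def)
  have hx: "h \<lless> x" "k \<lless> x" using gx h k q_trans g hk x by blast+
  show False
  proof (cases "x \<preceq> inv x")
    case True
    then show False using div_below[of x h k] hx x hk q_refl[OF x] by (simp add: x_def)
  next
    case False
    have "x \<lless> x \<otimes> inv k" using shift_both[of h k x] hx x hk by (simp add: x_def)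
    then have "inv x \<lless> x \<otimes> inv k \<otimes> inv x" using shift x hk by simp
    then have "conj_by G (inv x) (inv x) \<lless> conj_by G (inv x) (x \<otimes> inv k \<otimes> inv x)"
      using x hk by simp
    then have "inv x \<lless> inv k" using x hk by (simp add: conj_by_def m_assoc)
    then have "inv x \<lless> g" using k below_q_trans[of "inv x" "inv k" g] x g hk by simp
    then have "x \<lless> g" using inv_below[of g "inv x"] N x g by simp
    then show False using gx q_total x g by blast
  qed
qed

definition pos :: "'a \<Rightarrow> bool" where
  "pos x \<longleftrightarrow> inv x \<lless> x"

lemma o_plus_iff_pos: "x \<in> carrier G \<Longrightarrow> o_plus G q x \<longleftrightarrow> pos x"
  by (simp add: o_plus_def qless_iff pos_def)

lemma not_pos_one [simp]: "\<not> pos \<one>"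
  by (simp add: pos_def q_refl)

text \<open>If \<open>a\<close> is o^+-type and equivalent to \<open>b\<close>, then
  \<open>inv a \<lless> b\<close>; were \<open>b\<close> not o^+-type, \<open>inv_below\<close>
  would give \<open>a \<lless> b\<close>.\<close>

lemma pos_cong:
  assumes "x \<in> carrier G" "y \<in> carrier G" "x \<preceq> y" "y \<preceq> x"
  shows "pos x \<longleftrightarrow> pos y"
proof -
  have "pos b" if "a \<in> carrier G" "b \<in> carrier G" "a \<preceq> b" "b \<preceq> a" "pos a" for a b
  proof (rule ccontr)
    assume "\<not> pos b"
    moreover have "inv a \<lless> b" using that q_trans[of b a "inv a"] q_trans[of b "inv a" a] q_trans[of a b "inv a"] unfolding pos_def by auto
    ultimately have "a \<lless> b" using inv_below[of b "inv a"] that unfolding pos_def by simp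
    then show False using that by blast
  qed
  then show ?thesis using assms by blast
qed

lemma pos_conj [simp]: "\<lbrakk>z \<in> carrier G; x \<in> carrier G\<rbrakk> \<Longrightarrow> pos (conj_by G z x) \<longleftrightarrow> pos x"
  by (simp add: pos_def)

end

text \<open>The way back from the locale, with the C-relation that \<open>c_relation_of_iff\<close>
  forces. It serves for the quotients and for the lifting, where the locale axioms are easier to
  check.\<close>

lemma c_quasi_ordered_group_if_cqo_group:
  assumes "cqo_group G q"
  shows "c_quasi_ordered_group G q \<and>
    c_relation_of G q (\<lambda>x y z. \<not> q (x \<otimes>\<^bsub>G\<^esub> inv\<^bsub>G\<^esub> z) (y \<otimes>\<^bsub>G\<^esub> inv\<^bsub>G\<^esub> z))"
proof -
  interpret cqo_group G q by fact
  let ?C = "\<lambda>x y z. \<not> q (x \<otimes>\<^bsub>G\<^esub> inv\<^bsub>G\<^esub> z) (y \<otimes>\<^bsub>G\<^esub> inv\<^bsub>G\<^esub> z)"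
  have qo: "quasi_order_on (carrier G) q"
    unfolding quasi_order_on_def reflp_on_def transp_on_def totalp_on_def
    using q_refl q_trans q_total by blast
  have swap: "?C x z y" if "?C x y z" "x \<in> carrier G" "y \<in> carrier G" "z \<in> carrier G" for x y z
    using shift[of "y \<otimes>\<^bsub>G\<^esub> inv\<^bsub>G\<^esub> z" "x \<otimes>\<^bsub>G\<^esub> inv\<^bsub>G\<^esub> z"] that by (simp add: m_assoc inv_mult_group)
  have "c_relation_on (carrier G) ?C"
    unfolding c_relation_on_def
  proof (intro conjI ballI impI)
    show "?C x z y" if "?C x y z" "x \<in> carrier G" "y \<in> carrier G" "z \<in> carrier G" for x y z
      using swap that by blast
    show "\<not> ?C y x z" if "?C x y z" "x \<in> carrier G" "y \<in> carrier G" "z \<in> carrier G" for x y z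
      using q_total[of "x \<otimes>\<^bsub>G\<^esub> inv\<^bsub>G\<^esub> z" "y \<otimes>\<^bsub>G\<^esub> inv\<^bsub>G\<^esub> z"] that by simp
    show "?C w y z \<or> ?C x w z"
      if "?C x y z" "x \<in> carrier G" "y \<in> carrier G" "z \<in> carrier G" "w \<in> carrier G" for x y z w
      using q_trans[of "x \<otimes>\<^bsub>G\<^esub> inv\<^bsub>G\<^esub> z" "w \<otimes>\<^bsub>G\<^esub> inv\<^bsub>G\<^esub> z" "y \<otimes>\<^bsub>G\<^esub> inv\<^bsub>G\<^esub> z"] that by auto
    show "?C x y y" if "x \<noteq> y" "x \<in> carrier G" "y \<in> carrier G" for x y
      using q_one[of "x \<otimes>\<^bsub>G\<^esub> inv\<^bsub>G\<^esub> y"] that by (auto simp: inv_solve_right')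
  qed
  moreover have "compatible G ?C"
    unfolding compatible_def
  proof (intro ballI impI)
    fix x y z u v
    assume *: "x \<in> carrier G" "y \<in> carrier G" "z \<in> carrier G" "u \<in> carrier G" "v \<in> carrier G"
      "?C x y z"
    then have "\<not> q (conj_by G v (x \<otimes>\<^bsub>G\<^esub> inv\<^bsub>G\<^esub> z)) (conj_by G v (y \<otimes>\<^bsub>G\<^esub> inv\<^bsub>G\<^esub> z))" by simp
    then show "?C (v \<otimes>\<^bsub>G\<^esub> x \<otimes>\<^bsub>G\<^esub> u) (v \<otimes>\<^bsub>G\<^esub> y \<otimes>\<^bsub>G\<^esub> u) (v \<otimes>\<^bsub>G\<^esub> z \<otimes>\<^bsub>G\<^esub> u)"
      using * by (simp add: conj_by_def m_assoc inv_mult_group)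
  qed
  ultimately have "c_relation_of G q ?C"
    unfolding c_relation_of_def by simp
  then show ?thesis
    unfolding c_quasi_ordered_group_def using qo is_group by blast
qed

section \<open>Crests, linked elements and the preorder of type-components\<close>

context cqo_group
begin

text \<open>A crest is either \<open>o\<^sup>+\<close>-type or v-type, never \<open>o\<^sup>-\<close>-type, so type-components are governed by how
  the crests lie with respect to the \<open>o\<^sup>+\<close>-type elements.\<close>

definition crest :: "'a \<Rightarrow> 'a" where
  "crest x = (if inv x \<preceq> x then x else inv x)"

lemma crest_closed [simp]: "x \<in> carrier G \<Longrightarrow> crest x \<in> carrier G"
  by (simp add: crest_def)

lemma le_crest:
  assumes "x \<in> carrier G"
  shows "x \<preceq> crest x" "inv x \<preceq> crest x"
  using assms q_total[of x "inv x"] q_refl[of x] q_refl[of "inv x"] by (auto simp: crest_def)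

lemma inv_crest_le: "x \<in> carrier G \<Longrightarrow> inv (crest x) \<preceq> crest x"
  using q_total[of x "inv x"] by (auto simp: crest_def)

lemma crest_cases: "crest x = x \<or> crest x = inv x"
  by (simp add: crest_def)

lemma crest_crest [simp]: "x \<in> carrier G \<Longrightarrow> crest (crest x) = crest x"
  using inv_crest_le by (simp add: crest_def[of "crest x"])

lemma crest_one [simp]: "crest \<one> = \<one>"
  by (simp add: crest_def)

lemma crest_eq_one_iff [simp]: "x \<in> carrier G \<Longrightarrow> crest x = \<one> \<longleftrightarrow> x = \<one>"
  using crest_cases[of x] by (metis crest_one inv_inv inv_one)

lemma crest_le_iff:
  assumes "x \<in> carrier G" "y \<in> carrier G"
  shows "crest x \<preceq> y \<longleftrightarrow> x \<preceq> y \<and> inv x \<preceq> y"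
  using assms le_crest[OF assms(1)] q_trans[of x "crest x" y] q_trans[of "inv x" "crest x" y]
    crest_cases[of x] by auto

lemma crest_inv_le: "x \<in> carrier G \<Longrightarrow> crest (inv x) \<preceq> crest x"
  using le_crest by (simp add: crest_le_iff)

lemma crest_conj [simp]:
  "\<lbrakk>z \<in> carrier G; x \<in> carrier G\<rbrakk> \<Longrightarrow> crest (conj_by G z x) = conj_by G z (crest x)"
  by (simp add: crest_def)

lemma crest_pos: "pos x \<Longrightarrow> x \<in> carrier G \<Longrightarrow> crest x = x"
  using q_total[of x "inv x"] by (auto simp: crest_def pos_def)

lemma crest_not_pos: "\<not> pos (crest x) \<Longrightarrow> x \<in> carrier G \<Longrightarrow> crest x \<preceq> inv (crest x)"
  by (simp add: pos_def)

text \<open>The kinds distinguished are \<open>\<one>\<close>, o^+-type and neither. For crests the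
  last kind means non-trivial v-type, so one condition serves for v-components and o-components
  alike.\<close>

definition linked :: "'a \<Rightarrow> 'a \<Rightarrow> bool" where
  "linked a b \<longleftrightarrow>
     (\<forall>k\<in>carrier G. between q a b k \<longrightarrow> (k = \<one> \<longleftrightarrow> a = \<one>) \<and> (pos k \<longleftrightarrow> pos a))"

lemma linkedD:
  "\<lbrakk>linked a b; k \<in> carrier G; between q a b k\<rbrakk> \<Longrightarrow> (k = \<one> \<longleftrightarrow> a = \<one>) \<and> (pos k \<longleftrightarrow> pos a)"
  by (simp add: linked_def)

lemma between_end:
  assumes "a \<in> carrier G" "b \<in> carrier G"
  shows "between q a b a" "between q a b b"
  using assms q_refl q_total by (auto simp: between_def)

lemma between_commute: "between q a b k \<longleftrightarrow> between q b a k"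
  by (auto simp: between_def)

lemma linked_kind:
  assumes "a \<in> carrier G" "b \<in> carrier G" "linked a b"
  shows "(b = \<one> \<longleftrightarrow> a = \<one>) \<and> (pos b \<longleftrightarrow> pos a)"
  using linkedD[OF assms(3,2)] between_end assms by blast

lemma linked_refl:
  assumes "a \<in> carrier G" shows "linked a a"
  unfolding linked_def
proof (intro ballI impI)
  fix k assume k: "k \<in> carrier G" "between q a a k"
  then have "k \<preceq> a" "a \<preceq> k" by (auto simp: between_def)
  then show "(k = \<one> \<longleftrightarrow> a = \<one>) \<and> (pos k \<longleftrightarrow> pos a)"
    using pos_cong[of k a] q_one[of k] q_one[of a] assms k by auto
qed

lemma linked_sym:
  assumes "a \<in> carrier G" "b \<in> carrier G" "linked a b"
  shows "linked b a"
  using assms linked_kind[OF assms] between_commute[of a b] by (simp add: linked_def)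

lemma between_split:
  assumes "a \<in> carrier G" "b \<in> carrier G" "c \<in> carrier G" "k \<in> carrier G" "between q a c k"
  shows "between q a b k \<or> between q b c k"
  using assms q_total[of k b] by (auto simp: between_def)

lemma linked_trans:
  assumes "a \<in> carrier G" "b \<in> carrier G" "c \<in> carrier G" "linked a b" "linked b c"
  shows "linked a c"
  unfolding linked_def
proof (intro ballI impI)
  fix k assume k: "k \<in> carrier G" "between q a c k"
  show "(k = \<one> \<longleftrightarrow> a = \<one>) \<and> (pos k \<longleftrightarrow> pos a)"
    using between_split[OF assms(1-3) k] linked_kind[OF assms(1,2,4)] linkedD[OF assms(4) k(1)]
      linkedD[OF assms(5) k(1)] by blast
qed

lemma linked_between:
  assumes "a \<in> carrier G" "b \<in> carrier G" "c \<in> carrier G" "linked a c" "between q a c b"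
  shows "linked a b"
  unfolding linked_def
proof (intro ballI impI)
  fix k assume k: "k \<in> carrier G" "between q a b k"
  have "between q a c k"
    using k assms q_trans[of a b k] q_trans[of k b c] q_trans[of k a b] q_trans[of c b k]
      q_trans[of b a k] q_trans[of k b a]
    unfolding between_def by satx
  then show "(k = \<one> \<longleftrightarrow> a = \<one>) \<and> (pos k \<longleftrightarrow> pos a)"
    using linkedD assms(4) k by blast
qed

definition link_le :: "'a \<Rightarrow> 'a \<Rightarrow> bool" where
  "link_le a b \<longleftrightarrow> linked a b \<or> a \<preceq> b"

text \<open>Only \<open>c \<preceq> a\<close> needs an argument. In the mixed cases one of the three
  elements then lies between two linked ones, and linked sets are convex by
  \<open>linked_between\<close>.\<close>

lemma link_le_trans:
  assumes abc: "a \<in> carrier G" "b \<in> carrier G" "c \<in> carrier G" and "link_le a b" "link_le b c"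
  shows "link_le a c"
proof (cases "a \<preceq> c")
  case True
  then show ?thesis by (simp add: link_le_def)
next
  case False
  then have ca: "c \<preceq> a" using q_total abc by blast
  have "linked a c"
  proof (cases "linked a b")
    case ab: True
    show ?thesis
    proof (cases "linked b c")
      case True
      then show ?thesis using ab linked_trans abc by blast
    next
      case False
      then have "b \<preceq> c" using assms by (simp add: link_le_def)
      then have "between q a b c" using ca by (simp add: between_def)
      then show ?thesis using linked_between ab abc by blast
    qed
  next
    case not_ab: False
    then have "a \<preceq> b" using assms by (simp add: link_le_def)
    then have "\<not> b \<preceq> c" using False q_trans abc by blast
    then have bc: "linked c b" using assms linked_sym by (auto simp: link_le_def)
    moreover have "between q c b a" using ca \<open>a \<preceq> b\<close> by (simp add: between_def)
    ultimately show ?thesis using linked_between linked_sym abc by blast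
  qed
  then show ?thesis by (simp add: link_le_def)
qed

lemma link_le_antisym:
  assumes "a \<in> carrier G" "b \<in> carrier G"
  shows "link_le a b \<and> link_le b a \<longleftrightarrow> linked a b"
proof
  assume *: "link_le a b \<and> link_le b a"
  show "linked a b"
  proof (rule ccontr)
    assume n: "\<not> linked a b"
    then have "\<not> linked b a" using linked_sym assms by blast
    then have "a \<preceq> b" "b \<preceq> a" using * n by (auto simp: link_le_def)
    then have "between q a a b" by (simp add: between_def)
    then show False using n linked_between linked_refl assms by blast
  qed
qed (use linked_sym assms in \<open>auto simp: link_le_def\<close>)

text \<open>The order runs against that of the values: \<open>comp_le g h\<close> means that the
  value of \<open>g\<close> is at least the value of \<open>h\<close>, see
  \<open>type_le_rev_iff\<close>.\<close>

definition comp_le :: "'a \<Rightarrow> 'a \<Rightarrow> bool" where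
  "comp_le g h \<longleftrightarrow> link_le (crest g) (crest h)"

abbreviation comp_less :: "'a \<Rightarrow> 'a \<Rightarrow> bool" where
  "comp_less g h \<equiv> \<not> comp_le h g"

lemma comp_le_trans:
  "\<lbrakk>a \<in> carrier G; b \<in> carrier G; c \<in> carrier G; comp_le a b; comp_le b c\<rbrakk> \<Longrightarrow> comp_le a c"
  unfolding comp_le_def using link_le_trans crest_closed by blast

lemma comp_le_total: "\<lbrakk>a \<in> carrier G; b \<in> carrier G\<rbrakk> \<Longrightarrow> comp_le a b \<or> comp_le b a"
  unfolding comp_le_def link_le_def using q_total crest_closed by blast

lemma comp_le_refl: "a \<in> carrier G \<Longrightarrow> comp_le a a"
  using comp_le_total by blast

lemma comp_less_imp_le: "\<lbrakk>a \<in> carrier G; b \<in> carrier G; comp_less a b\<rbrakk> \<Longrightarrow> comp_le a b"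
  using comp_le_total by blast

lemma comp_le_if_crest_le: "crest a \<preceq> crest b \<Longrightarrow> comp_le a b"
  by (simp add: comp_le_def link_le_def)

lemma comp_le_one_iff:
  assumes "a \<in> carrier G" shows "comp_le a \<one> \<longleftrightarrow> a = \<one>"
  using assms linked_kind[of "crest a" \<one>] q_one[of "crest a"] comp_le_refl[of \<one>]
  by (auto simp: comp_le_def link_le_def)

lemma one_comp_le: "a \<in> carrier G \<Longrightarrow> comp_le \<one> a"
  by (rule comp_le_if_crest_le) (simp add: one_least)

lemma comp_less_crestD: "\<lbrakk>a \<in> carrier G; b \<in> carrier G; comp_less a b\<rbrakk> \<Longrightarrow> crest a \<lless> crest b"
  using comp_le_if_crest_le by blast

text \<open>For v-type \<open>a\<close> the crests of \<open>a\<close> and \<open>inv a\<close> may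
  differ, but they are equivalent.\<close>

lemma comp_le_inv_iff [simp]:
  assumes "a \<in> carrier G" "b \<in> carrier G"
  shows "comp_le (inv a) b \<longleftrightarrow> comp_le a b" "comp_le b (inv a) \<longleftrightarrow> comp_le b a"
proof -
  have "comp_le (inv a) a" "comp_le a (inv a)"
    using crest_inv_le[of a] crest_inv_le[of "inv a"] assms by (auto intro: comp_le_if_crest_le)
  then show "comp_le (inv a) b \<longleftrightarrow> comp_le a b" "comp_le b (inv a) \<longleftrightarrow> comp_le b a"
    using comp_le_trans[of a "inv a" b] comp_le_trans[of "inv a" a b]
      comp_le_trans[of b "inv a" a] comp_le_trans[of b a "inv a"] assms by auto
qed

lemma comp_le_crest_iff [simp]:
  assumes "a \<in> carrier G" "b \<in> carrier G"
  shows "comp_le (crest a) b \<longleftrightarrow> comp_le a b" "comp_le b (crest a) \<longleftrightarrow> comp_le b a"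
  using crest_cases[of a] assms by auto

lemma between_conj [simp]:
  "\<lbrakk>z \<in> carrier G; a \<in> carrier G; b \<in> carrier G; k \<in> carrier G\<rbrakk>
    \<Longrightarrow> between q (conj_by G z a) (conj_by G z b) (conj_by G z k) \<longleftrightarrow> between q a b k"
  by (simp add: between_def)

lemma linked_conj_if:
  assumes z: "z \<in> carrier G" and ab: "a \<in> carrier G" "b \<in> carrier G" "linked a b"
  shows "linked (conj_by G z a) (conj_by G z b)"
  unfolding linked_def
proof (intro ballI impI)
  fix k assume k: "k \<in> carrier G" "between q (conj_by G z a) (conj_by G z b) k"
  have "between q a b (conj_by G (inv z) k)"
    using between_conj[of z a b "conj_by G (inv z) k"] k z ab by simp
  then show "(k = \<one> \<longleftrightarrow> conj_by G z a = \<one>) \<and> (pos k \<longleftrightarrow> pos (conj_by G z a))"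
    using linkedD[OF ab(3), of "conj_by G (inv z) k"] k z ab by simp
qed

lemma comp_le_conj_iff [simp]:
  assumes "z \<in> carrier G" "a \<in> carrier G" "b \<in> carrier G"
  shows "comp_le (conj_by G z a) (conj_by G z b) \<longleftrightarrow> comp_le a b"
proof -
  have "linked (conj_by G z (crest a)) (conj_by G z (crest b)) \<longleftrightarrow> linked (crest a) (crest b)"
    using linked_conj_if[of z "crest a" "crest b"]
      linked_conj_if[of "inv z" "conj_by G z (crest a)" "conj_by G z (crest b)"] assms by auto
  then show ?thesis using assms by (simp add: comp_le_def link_le_def)
qed

section \<open>The ultrametric inequality for type-components\<close>

text \<open>If there were no such \<open>k\<close>, everything between the crests would be o^+-type
  and the crests would be linked. The separator is the threshold at which \<open>inv_below\<close>
  and \<open>div_le\<close> get applied.\<close>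

lemma comp_less_separator:
  assumes ab: "a \<in> carrier G" "b \<in> carrier G" and less: "comp_less a b"
  obtains k where "k \<in> carrier G" "\<not> pos k" "crest a \<preceq> k" "k \<preceq> crest b"
proof (cases "\<exists>k\<in>carrier G. \<not> pos k \<and> crest a \<preceq> k \<and> k \<preceq> crest b")
  case True
  then show ?thesis using that by blast
next
  case False
  have le: "crest a \<lless> crest b" "crest a \<preceq> crest b"
    using comp_less_crestD q_le_if_below less ab by auto
  have pos: "pos k" if "k \<in> carrier G" "between q (crest b) (crest a) k" for k
    using that False le q_trans[of "crest b" k "crest a"] ab by (auto simp: between_def)
  have "linked (crest b) (crest a)"
    unfolding linked_def
  proof (intro ballI impI)
    fix k assume k: "k \<in> carrier G" "between q (crest b) (crest a) k"
    have "pos k" "pos (crest b)" using pos k between_end[of "crest b" "crest a"] ab by auto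
    then show "(k = \<one> \<longleftrightarrow> crest b = \<one>) \<and> (pos k \<longleftrightarrow> pos (crest b))"
      using not_pos_one by metis
  qed
  then show ?thesis using less by (simp add: comp_le_def link_le_def)
qed

text \<open>Let \<open>k\<close> separate the crests. If \<open>b \<lless> a\<close>, then
  \<open>b \<lless> k\<close>, hence \<open>inv b \<lless> k\<close> by \<open>inv_below\<close>,
  and \<open>crest b\<close> would be strictly below \<open>k\<close>.\<close>

lemma q_le_if_comp_less:
  assumes ab: "a \<in> carrier G" "b \<in> carrier G" and less: "comp_less a b"
  shows "a \<preceq> b"
proof (rule ccontr)
  assume "b \<lless> a"
  moreover obtain k where k: "k \<in> carrier G" "\<not> pos k" "crest a \<preceq> k" "k \<preceq> crest b"
    using comp_less_separator assms by blast
  moreover have "a \<preceq> k" using q_trans[of a "crest a" k] le_crest k ab by simp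
  ultimately have bk: "b \<lless> k" using below_q_trans ab by blast
  then have "inv b \<lless> k" using inv_below[of k b] k ab by (simp add: pos_def)
  then have "crest b \<lless> k" using bk crest_cases[of b] by auto
  then show False using k by blast
qed

text \<open>Otherwise some \<open>k\<close> that is not o^+-type separates \<open>y\<close> from the
  quotient. By \<open>div_le\<close> the crest of the quotient is at most \<open>k\<close>, so it is
  equivalent to \<open>k\<close> and not o^+-type itself. Then \<open>div_below\<close> with this
  crest as threshold puts the crest strictly below itself.\<close>

lemma comp_le_div_crest:
  assumes xy: "x \<in> carrier G" "y \<in> carrier G" "crest x \<preceq> crest y"
  shows "comp_le (x \<otimes> inv y) y"
proof (rule ccontr)
  let ?w = "crest (x \<otimes> inv y)"
  assume n: "\<not> ?thesis"
  then obtain k where k: "k \<in> carrier G" "\<not> pos k" "crest y \<preceq> k" "k \<preceq> ?w"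
    using comp_less_separator[of y "x \<otimes> inv y"] xy by auto
  have yw: "crest y \<lless> ?w" using comp_less_crestD[of y "x \<otimes> inv y"] n xy by simp
  have kN: "k \<preceq> inv k" using k by (simp add: pos_def)
  have "crest x \<preceq> k" using q_trans[of "crest x" "crest y" k] xy k by simp
  then have "x \<preceq> k" "inv x \<preceq> k" "y \<preceq> k" "inv y \<preceq> k" using k xy by (simp_all add: crest_le_iff)
  then have "x \<otimes> inv y \<preceq> k" "y \<otimes> inv x \<preceq> k" using div_le kN k xy by auto
  then have "?w \<preceq> k" using k xy by (simp add: crest_le_iff inv_mult_group)
  then have wN: "?w \<preceq> inv ?w"
    using pos_cong[of k ?w] k xy by (simp add: pos_def)
  have "crest x \<lless> ?w" using q_below_trans[of "crest x" "crest y" ?w] xy yw by simp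
  then have "x \<lless> ?w" "y \<lless> ?w"
    using q_below_trans[of x "crest x" ?w] q_below_trans[of y "crest y" ?w] yw le_crest xy by auto
  then have "x \<otimes> inv y \<lless> ?w" "y \<otimes> inv x \<lless> ?w" using div_below wN xy by auto
  then show False using crest_cases[of "x \<otimes> inv y"] q_refl[of ?w] xy by (auto simp: inv_mult_group)
qed

lemma comp_le_div:
  assumes xy: "x \<in> carrier G" "y \<in> carrier G" and "comp_le x y"
  shows "comp_le (x \<otimes> inv y) y"
proof (cases "crest x \<preceq> crest y")
  case True
  then show ?thesis using comp_le_div_crest xy by blast
next
  case False
  then have "comp_le (y \<otimes> inv x) x" using comp_le_div_crest q_total[of "crest x" "crest y"] xy by auto
  then have "comp_le (inv (x \<otimes> inv y)) y"
    using comp_le_trans[of "y \<otimes> inv x" x y] assms by (simp add: inv_mult_group)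
  then show ?thesis using comp_le_inv_iff(1)[of "x \<otimes> inv y" y] xy by simp
qed

lemma comp_le_div_max:
  assumes xy: "x \<in> carrier G" "y \<in> carrier G"
  shows "comp_le (x \<otimes> inv y) x \<or> comp_le (x \<otimes> inv y) y"
proof (cases "comp_le x y")
  case True
  then show ?thesis using comp_le_div xy by blast
next
  case False
  then have "comp_le (y \<otimes> inv x) x" using comp_le_div comp_le_total xy by blast
  then have "comp_le (inv (x \<otimes> inv y)) x" using xy by (simp add: inv_mult_group)
  then show ?thesis using comp_le_inv_iff(1)[of "x \<otimes> inv y" x] xy by simp
qed

lemma comp_le_mult_max:
  assumes xy: "x \<in> carrier G" "y \<in> carrier G"
  shows "comp_le (x \<otimes> y) x \<or> comp_le (x \<otimes> y) y"
  using comp_le_div_max[of x "inv y"] xy by simp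

text \<open>If \<open>y \<lless> x \<otimes> y\<close>, then \<open>shift\<close> gives
  \<open>inv y \<lless> x\<close>, against \<open>q_le_if_comp_less\<close>. The other inequality is
  the first one for \<open>inv x\<close> and \<open>x \<otimes> y\<close>; the ultrametric
  inequality shows that \<open>x \<otimes> y\<close> still has a larger component than
  \<open>x\<close>.\<close>

lemma q_equiv_mult_small:
  assumes xy: "x \<in> carrier G" "y \<in> carrier G" and less: "comp_less x y"
  shows "x \<otimes> y \<preceq> y" "y \<preceq> x \<otimes> y"
proof -
  have *: "a \<otimes> b \<preceq> b" if "a \<in> carrier G" "b \<in> carrier G" "comp_less a b" for a b
  proof (rule ccontr)
    assume "\<not> ?thesis"
    then have "inv b \<lless> a" using shift[of b "a \<otimes> b"] that by (simp add: m_assoc)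
    moreover have "a \<preceq> inv b" using q_le_if_comp_less[of a "inv b"] that by simp
    ultimately show False by blast
  qed
  show "x \<otimes> y \<preceq> y" using * assms by blast
  have "comp_less (inv x) (x \<otimes> y)"
  proof
    assume "comp_le (x \<otimes> y) (inv x)"
    then have "comp_le (x \<otimes> y) x" using xy by simp
    moreover have "comp_le y (inv x) \<or> comp_le y (x \<otimes> y)"
      using comp_le_mult_max[of "inv x" "x \<otimes> y"] xy by simp
    ultimately show False using less comp_le_trans[of y "x \<otimes> y" x] xy by auto
  qed
  then show "y \<preceq> x \<otimes> y" using *[of "inv x" "x \<otimes> y"] xy by simp
qed

section \<open>The subgroups \<open>up g\<close> and \<open>down g\<close>, which are G^\<gamma> and
  G_\<gamma> for the value \<gamma> of \<open>g\<close>\<close>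

definition up :: "'a \<Rightarrow> 'a set" where
  "up g = {x \<in> carrier G. comp_le x g}"

definition down :: "'a \<Rightarrow> 'a set" where
  "down g = {x \<in> carrier G. comp_less x g}"

lemma subgroup_if_comp_downward:
  assumes "S \<subseteq> carrier G" "\<one> \<in> S"
    and down: "\<And>x y. \<lbrakk>x \<in> carrier G; y \<in> S; comp_le x y\<rbrakk> \<Longrightarrow> x \<in> S"
  shows "subgroup S G"
proof (rule subgroupI)
  show "S \<subseteq> carrier G" "S \<noteq> {}" using assms by auto
  show "inv a \<in> S" if "a \<in> S" for a
  proof -
    have "a \<in> carrier G" using that assms by blast
    then show ?thesis using down[of "inv a" a] that comp_le_refl by simp
  qed
  show "a \<otimes> b \<in> S" if ab: "a \<in> S" "b \<in> S" for a b
  proof -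
    have G: "a \<in> carrier G" "b \<in> carrier G" using ab assms by auto
    then show ?thesis using comp_le_mult_max[OF G] down ab by blast
  qed
qed

text \<open>Only the upper bound \<open>t\<close> matters: the contrapositive of
  \<open>q_le_if_comp_less\<close> turns the strict inequality \<open>a \<lless> t\<close> into
  \<open>comp_le a t\<close>.\<close>

lemma strictly_convex_if_comp_downward:
  assumes "S \<subseteq> carrier G"
    and down: "\<And>x y. \<lbrakk>x \<in> carrier G; y \<in> S; comp_le x y\<rbrakk> \<Longrightarrow> x \<in> S"
  shows "strictly_convex G q S"
  unfolding strictly_convex_def
proof (intro conjI ballI impI)
  show "S \<subseteq> carrier G" by fact
  fix s t a assume *: "s \<in> S" "t \<in> S" "a \<in> carrier G" "qless q s a \<and> qless q a t"
  then have t: "t \<in> carrier G" using assms by blast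
  then have "a \<lless> t" using * by (simp add: qless_iff)
  then have "comp_le a t" using q_le_if_comp_less t * by blast
  then show "a \<in> S" using down * by blast
qed

lemma up_downward: "\<lbrakk>g \<in> carrier G; x \<in> carrier G; y \<in> up g; comp_le x y\<rbrakk> \<Longrightarrow> x \<in> up g"
  unfolding up_def using comp_le_trans by blast

lemma down_downward: "\<lbrakk>g \<in> carrier G; x \<in> carrier G; y \<in> down g; comp_le x y\<rbrakk> \<Longrightarrow> x \<in> down g"
  unfolding down_def using comp_le_trans by blast

lemma subgroup_up: "g \<in> carrier G \<Longrightarrow> subgroup (up g) G"
  by (rule subgroup_if_comp_downward[OF _ _ up_downward]) (auto simp: up_def one_comp_le)

lemma subgroup_down: "\<lbrakk>g \<in> carrier G; g \<noteq> \<one>\<rbrakk> \<Longrightarrow> subgroup (down g) G"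
  by (rule subgroup_if_comp_downward[OF _ _ down_downward]) (auto simp: down_def comp_le_one_iff)

lemma down_subset_up: "g \<in> carrier G \<Longrightarrow> down g \<subseteq> up g"
  unfolding up_def down_def using comp_le_total by blast

text \<open>An element \<open>u\<close> outside \<open>down g\<close> has the value of
  \<open>g\<close> and is fixed by conjugation with itself. As conjugation respects the comparison
  of values, it keeps the value of \<open>x\<close> above that of \<open>u\<close>.\<close>

lemma conj_down:
  assumes g: "g \<in> carrier G" "g \<noteq> \<one>" and u: "u \<in> up g" and x: "x \<in> down g"
  shows "conj_by G u x \<in> down g"
proof (cases "u \<in> down g")
  case True
  then show ?thesis
    using subgroup_down[OF g] x unfolding conj_by_def
    by (simp add: subgroup.m_closed subgroup.m_inv_closed)
next
  case False
  have G: "u \<in> carrier G" "x \<in> carrier G" using u x by (auto simp: up_def down_def)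
  have gu: "comp_le g u" "comp_le u g" using False u by (auto simp: up_def down_def)
  then have "comp_less x u" using x comp_le_trans[of g u x] G g by (auto simp: down_def)
  then have "comp_less (conj_by G u x) (conj_by G u u)" using G by simp
  moreover have "conj_by G u u = u" using G by (simp add: conj_by_def m_assoc)
  ultimately have "comp_less (conj_by G u x) g"
    using gu comp_le_trans[of u g "conj_by G u x"] G g by auto
  then show ?thesis using G by (simp add: down_def)
qed

section \<open>Type-components as classes of linked crests, and the type-valuation\<close>

text \<open>Elements of o^+-type and of v-type are their own crests, and an o^--type element has its
  inverse as crest. So the inverses adjoined in \<open>o_component\<close> and the passage to the
  inverse in \<open>type_component\<close> both amount to taking crests.\<close>

lemma type_component_eq_linked:
  assumes g: "g \<in> carrier G"
  shows "type_component G q g = {h \<in> carrier G. linked (crest h) (crest g)}"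
proof -
  have o: "o_component G q p = {h \<in> carrier G. linked (crest h) p}"
    if p: "p \<in> carrier G" "pos p" for p
  proof -
    have part: "h \<in> o_plus_part G q p \<longleftrightarrow> h \<in> carrier G \<and> pos h \<and> linked h p" for h
    proof (cases "h \<in> carrier G")
      case h: True
      have "pos h \<and> (\<forall>k\<in>carrier G. between q p h k \<longrightarrow> pos k) \<longleftrightarrow> pos h \<and> linked h p"
      proof (cases "pos h")
        case True
        then have "k = \<one> \<longleftrightarrow> h = \<one>" if "pos k" for k
          using that not_pos_one by metis
        then show ?thesis using True unfolding between_commute[of p h] linked_def by blast
      qed simp
      then show ?thesis using h by (simp add: o_plus_part_def o_plus_iff_pos)
    qed (simp add: o_plus_part_def)
    show ?thesis
    proof (intro equalityI subsetI)
      fix h assume "h \<in> o_component G q p"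
      then consider "h \<in> o_plus_part G q p" | k where "k \<in> o_plus_part G q p" "h = inv k"
        by (auto simp: o_component_def)
      then show "h \<in> {h \<in> carrier G. linked (crest h) p}"
      proof cases
        case 1
        then show ?thesis using crest_pos part by simp
      next
        case 2
        then have k: "k \<in> carrier G" "pos k" "linked k p" using part by auto
        then have "crest h = k" using q_total[of k "inv k"] 2 by (auto simp: crest_def pos_def)
        then show ?thesis using k 2 by simp
      qed
    next
      fix h assume "h \<in> {h \<in> carrier G. linked (crest h) p}"
      then have h: "h \<in> carrier G" "linked (crest h) p" by auto
      then have "pos (crest h)" using linked_kind[of "crest h" p] p by simp
      then have ch: "crest h \<in> o_plus_part G q p" using part h by simp
      show "h \<in> o_component G q p"
      proof (cases "crest h = h")
        case True
        then show ?thesis using ch by (simp add: o_component_def)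
      next
        case False
        then have "h = inv (crest h)" using crest_cases[of h] h by simp
        then show ?thesis using ch by (auto simp: o_component_def)
      qed
    qed
  qed
  consider "g = \<one>" | "g \<noteq> \<one>" "v_type G q g" | "g \<noteq> \<one>" "\<not> v_type G q g" "pos g"
    | "g \<noteq> \<one>" "\<not> v_type G q g" "pos (inv g)"
  proof -
    have "\<not> v_type G q g \<longrightarrow> pos g \<or> pos (inv g)"
      using q_total[of g "inv g"] g by (simp add: v_type_def qsim_def pos_def)
    then show ?thesis using that by metis
  qed
  then show ?thesis
  proof cases
    case 1
    have "linked (crest h) \<one> \<longleftrightarrow> h = \<one>" if "h \<in> carrier G" for h
      using linked_kind[of "crest h" \<one>] linked_refl[of \<one>] that by auto
    then show ?thesis using 1 by (auto simp: type_component_def)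
  next
    case 2
    have cg: "crest g = g" "\<not> pos g" using 2 by (auto simp: crest_def v_type_def qsim_def pos_def)
    have "h \<noteq> \<one> \<and> v_type G q h \<and> \<not> (\<exists>k\<in>carrier G. o_plus G q k \<and> between q h g k)
      \<longleftrightarrow> linked (crest h) g" if h: "h \<in> carrier G" for h
    proof
      assume L: "linked (crest h) g"
      then have k: "\<not> pos (crest h)" "h \<noteq> \<one>" using linked_kind[of "crest h" g] g h cg 2 by auto
      have vh: "v_type G q h"
        using crest_cases[of h] inv_crest_le[OF h] crest_not_pos[OF k(1) h] h
        by (auto simp: v_type_def qsim_def)
      then have "crest h = h" by (simp add: crest_def v_type_def qsim_def)
      then show "h \<noteq> \<one> \<and> v_type G q h \<and> \<not> (\<exists>k\<in>carrier G. o_plus G q k \<and> between q h g k)"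
        using L k vh linkedD[of h g] by (auto simp: o_plus_iff_pos)
    next
      assume R: "h \<noteq> \<one> \<and> v_type G q h \<and> \<not> (\<exists>k\<in>carrier G. o_plus G q k \<and> between q h g k)"
      then have ch: "crest h = h" "\<not> pos h" by (auto simp: crest_def v_type_def qsim_def pos_def)
      \<comment> \<open>Whatever lies between \<open>h\<close> and \<open>g\<close> is above one of
        these non-trivial elements and hence not \<open>\<one>\<close>.\<close>
      have "k \<noteq> \<one> \<and> \<not> pos k" if "k \<in> carrier G" "between q h g k" for k
        using that R q_one[of g] q_one[of h] g h 2 by (auto simp: between_def o_plus_iff_pos)
      then show "linked (crest h) g" using ch R by (simp add: linked_def)
    qed
    then show ?thesis using 2 cg by (auto simp: type_component_def v_component_def)
  next
    case 3
    then show ?thesis using o[of g] g crest_pos by (simp add: type_component_def o_plus_iff_pos)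
  next
    case 4
    then have n: "\<not> pos g" "crest g = inv g" using q_total[of g "inv g"] g by (auto simp: pos_def crest_def)
    have "type_component G q g = o_component G q (inv g)"
      using 4 n(1) g by (simp add: type_component_def o_plus_iff_pos)
    then show ?thesis using o[of "inv g"] 4(3) g n(2) by simp
  qed
qed

lemma type_component_eq_iff:
  assumes "g \<in> carrier G" "h \<in> carrier G"
  shows "type_component G q g = type_component G q h \<longleftrightarrow> comp_le g h \<and> comp_le h g"
proof -
  have "comp_le g h \<and> comp_le h g \<longleftrightarrow> linked (crest g) (crest h)"
    using link_le_antisym assms by (simp add: comp_le_def)
  moreover have "type_component G q g = type_component G q h \<longleftrightarrow> linked (crest g) (crest h)"
  proof
    assume "type_component G q g = type_component G q h"
    moreover have "g \<in> type_component G q g"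
      using assms linked_refl by (simp add: type_component_eq_linked)
    ultimately show "linked (crest g) (crest h)" using assms by (simp add: type_component_eq_linked)
  next
    assume l: "linked (crest g) (crest h)"
    have "linked (crest x) (crest g) \<longleftrightarrow> linked (crest x) (crest h)" if "x \<in> carrier G" for x
      using l linked_trans[of "crest x" "crest g" "crest h"]
        linked_trans[of "crest x" "crest h" "crest g"] linked_sym[OF _ _ l] that assms by auto
    then show "type_component G q g = type_component G q h"
      using assms by (auto simp: type_component_eq_linked)
  qed
  ultimately show ?thesis by simp
qed

text \<open>For one direction the crests of \<open>g\<close> and \<open>h\<close> are members of the
  components that can be compared. For the other, members of different components are comparable by
  \<open>q_le_if_comp_less\<close>.\<close>

lemma type_le_rev_iff:
  assumes g: "g \<in> carrier G" and h: "h \<in> carrier G"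
  shows "type_le_rev q (type_component G q h) (type_component G q g) \<longleftrightarrow> comp_le g h"
proof
  assume "type_le_rev q (type_component G q h) (type_component G q g)"
  then consider "type_component G q g = type_component G q h"
    | "set_le q (type_component G q g) (type_component G q h)"
    by (auto simp: type_le_rev_def type_le_def)
  then show "comp_le g h"
  proof cases
    case 1
    then show ?thesis using type_component_eq_iff g h by blast
  next
    case 2
    have "crest g \<in> type_component G q g" "crest h \<in> type_component G q h"
      using g h linked_refl by (simp_all add: type_component_eq_linked)
    then have "crest g \<preceq> crest h" using 2 by (simp add: set_le_def)
    then show ?thesis by (rule comp_le_if_crest_le)
  qed
next
  assume le: "comp_le g h"
  show "type_le_rev q (type_component G q h) (type_component G q g)"
  proof (cases "comp_le h g")
    case True
    then show ?thesis using le type_component_eq_iff g h by (simp add: type_le_rev_def type_le_def)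
  next
    case False
    have "s \<preceq> t" if "s \<in> type_component G q g" "t \<in> type_component G q h" for s t
    proof (rule q_le_if_comp_less)
      show st: "s \<in> carrier G" "t \<in> carrier G" using that g h by (auto simp: type_component_eq_linked)
      have "linked (crest s) (crest g)" "linked (crest t) (crest h)"
        using that g h by (auto simp: type_component_eq_linked)
      then have "comp_le s g" "comp_le h t"
        using linked_sym[of "crest t" "crest h"] st g h by (auto simp: comp_le_def link_le_def)
      then show "comp_less s t"
        using False comp_le_trans[of h t g] comp_le_trans[of t s g] st g h by blast
    qed
    then show ?thesis by (simp add: type_le_rev_def type_le_def set_le_def)
  qed
qed

lemma qless_type_le_rev_iff:
  assumes "g \<in> carrier G" "h \<in> carrier G"
  shows "qless (type_le_rev q) (type_component G q h) (type_component G q g) \<longleftrightarrow> comp_less g h"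
  using assms comp_le_total by (auto simp: qless_def qsim_def type_le_rev_iff)

lemma val_ge_eq_up:
  "g \<in> carrier G \<Longrightarrow> val_ge G (type_le_rev q) (type_component G q) (type_component G q g) = up g"
  by (auto simp: val_ge_def up_def type_le_rev_iff)

lemma val_gt_eq_down:
  "g \<in> carrier G \<Longrightarrow> val_gt G (type_le_rev q) (type_component G q) (type_component G q g) = down g"
  by (auto simp: val_gt_def down_def qless_type_le_rev_iff)

lemma type_component_one: "type_component G q \<one> = {\<one>}"
  by (simp add: type_component_def)

lemma type_component_eq_one_iff:
  "g \<in> carrier G \<Longrightarrow> type_component G q g = {\<one>} \<longleftrightarrow> g = \<one>"
  using type_component_eq_iff[of g \<one>] comp_le_one_iff one_comp_le[of \<one>]
  by (auto simp: type_component_one)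

lemma valuation_type_component:
  "valuation G (type_values G q) (type_le_rev q) {\<one>} (type_component G q)"
proof -
  have img: "insert {\<one>} (type_values G q) = type_component G q ` carrier G"
    using type_component_one by (auto simp: type_values_def)
  have "total_order_on (type_component G q ` carrier G) (type_le_rev q)"
    unfolding total_order_on_def quasi_order_on_def
  proof (intro conjI)
    show "reflp_on (type_component G q ` carrier G) (type_le_rev q)"
      by (auto simp: reflp_on_def type_le_rev_iff comp_le_refl)
    show "transp_on (type_component G q ` carrier G) (type_le_rev q)"
      by (auto simp: transp_on_def type_le_rev_iff intro: comp_le_trans)
    show "totalp_on (type_component G q ` carrier G) (type_le_rev q)"
      using comp_le_total by (auto simp: totalp_on_def type_le_rev_iff)
    show "antisymp_on (type_component G q ` carrier G) (type_le_rev q)"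
      by (auto simp: antisymp_on_def type_le_rev_iff type_component_eq_iff)
  qed
  moreover have "qless (type_le_rev q) \<gamma> {\<one>}" if "\<gamma> \<in> type_values G q" for \<gamma>
    using that qless_type_le_rev_iff[of \<one>] comp_le_one_iff
    by (auto simp: type_values_def type_component_one)
  moreover have "{\<one>} \<notin> type_values G q"
    using type_component_eq_one_iff by (auto simp: type_values_def)
  ultimately show ?thesis
    unfolding valuation_def img
    using type_component_eq_one_iff comp_le_div_max by (auto simp: type_le_rev_iff)
qed

section \<open>Criteria for valuational and for order-type quasi-orders\<close>

text \<open>Applied to \<open>x\<close> and to \<open>inv x\<close>, the hypothesis makes every
  element v-type. The equivalence classes then serve as values, and \<open>div_le\<close> becomes
  the ultrametric inequality.\<close>

lemma valuational_if_v_type: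
  assumes v: "\<And>x. x \<in> carrier G \<Longrightarrow> inv x \<preceq> x"
  shows "valuational G q"
proof -
  \<comment> \<open>Small elements get large values; the class of \<open>\<one>\<close> is the value
    infinity.\<close>
  define leq :: "'a set \<Rightarrow> 'a set \<Rightarrow> bool" where "leq S T \<longleftrightarrow> (\<exists>s\<in>S. \<exists>t\<in>T. t \<preceq> s)" for S T
  let ?v = "qclass G q"
  have leq_iff: "leq (?v x) (?v y) \<longleftrightarrow> y \<preceq> x" if xy: "x \<in> carrier G" "y \<in> carrier G" for x y
  proof
    assume "leq (?v x) (?v y)"
    then obtain s t where st: "s \<in> carrier G" "t \<in> carrier G" "s \<preceq> x" "y \<preceq> t" "t \<preceq> s"
      by (auto simp: leq_def qclass_def qsim_def)
    then show "y \<preceq> x" using q_trans[of y t s] q_trans[of y s x] xy by blast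
  next
    assume "y \<preceq> x"
    moreover have "x \<in> ?v x" "y \<in> ?v y" using xy q_refl by (auto simp: qclass_def qsim_def)
    ultimately show "leq (?v x) (?v y)" by (auto simp: leq_def)
  qed
  have eq_iff: "?v x = ?v y \<longleftrightarrow> x \<preceq> y \<and> y \<preceq> x" if xy: "x \<in> carrier G" "y \<in> carrier G" for x y
  proof
    assume "?v x = ?v y"
    then show "x \<preceq> y \<and> y \<preceq> x" using leq_iff[OF xy] leq_iff[of y x] leq_iff[of x x] q_refl xy by auto
  next
    assume "x \<preceq> y \<and> y \<preceq> x"
    then show "?v x = ?v y"
      using q_trans[of x y] q_trans[of y x] q_trans[of _ y x] q_trans[of _ x y] xy
      unfolding qclass_def qsim_def by blast
  qed
  have less_iff: "qless leq (?v x) (?v y) \<longleftrightarrow> y \<lless> x" if xy: "x \<in> carrier G" "y \<in> carrier G" for x y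
    using leq_iff[OF xy] leq_iff[OF xy(2,1)] q_total[OF xy] by (auto simp: qless_def qsim_def)
  have div: "x \<otimes> inv y \<preceq> x \<or> x \<otimes> inv y \<preceq> y" if xy: "x \<in> carrier G" "y \<in> carrier G" for x y
  proof -
    \<comment> \<open>Here \<open>c\<close> is going to be the larger one of \<open>x\<close> and
      \<open>y\<close>.\<close>
    have *: "a \<otimes> inv b \<preceq> c"
      if "a \<in> carrier G" "b \<in> carrier G" "c \<in> carrier G" "a \<preceq> c" "b \<preceq> c" for a b c
      using div_le[of c a b] v[of "inv c"] v[of a] v[of b]
        q_trans[of "inv a" a c] q_trans[of "inv b" b c] that by simp
    show ?thesis using *[of x y x] *[of x y y] q_refl q_total xy by blast
  qed
  have one_iff: "?v x = ?v \<one> \<longleftrightarrow> x = \<one>" if "x \<in> carrier G" for x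
    using eq_iff[of x \<one>] q_one[of x] q_refl that by auto
  have img: "insert (?v \<one>) (?v ` (carrier G - {\<one>})) = ?v ` carrier G" by auto
  have "total_order_on (?v ` carrier G) leq"
    unfolding total_order_on_def quasi_order_on_def
  proof (intro conjI)
    show "reflp_on (?v ` carrier G) leq"
      by (auto simp: reflp_on_def leq_iff q_refl)
    show "transp_on (?v ` carrier G) leq"
      by (auto simp: transp_on_def leq_iff intro: q_trans)
    show "totalp_on (?v ` carrier G) leq"
      using q_total by (auto simp: totalp_on_def leq_iff)
    show "antisymp_on (?v ` carrier G) leq"
      by (auto simp: antisymp_on_def leq_iff eq_iff)
  qed
  moreover have "\<forall>\<gamma>\<in>?v ` (carrier G - {\<one>}). qless leq \<gamma> (?v \<one>)"
    using q_one by (auto simp: less_iff)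
  moreover have "?v \<one> \<notin> ?v ` (carrier G - {\<one>})"
    using one_iff by force
  ultimately have "valuation G (?v ` (carrier G - {\<one>})) leq (?v \<one>) ?v"
    unfolding valuation_def img using one_iff div by (auto simp: leq_iff)
  moreover have "\<forall>x\<in>carrier G. \<forall>y\<in>carrier G. \<forall>z\<in>carrier G.
      \<not> x \<otimes> inv z \<preceq> y \<otimes> inv z \<longleftrightarrow> qless leq (?v (x \<otimes> inv z)) (?v (y \<otimes> inv z))"
    by (simp add: less_iff)
  ultimately show ?thesis
    using c_quasi_ordered_group_if_cqo_group[OF cqo_group_axioms]
    unfolding valuational_def by blast
qed

text \<open>The ultrametric inequality for \<open>\<one>\<close> and \<open>x\<close> shows that
  \<open>inv x\<close> has at least the value of \<open>x\<close>.\<close>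

lemma v_type_if_valuational:
  assumes "valuational G q" and x: "x \<in> carrier G"
  shows "inv x \<preceq> x"
proof -
  from assms obtain C \<Gamma> leq infty v
    where C: "c_relation_of G q C" and val: "valuation G (\<Gamma> :: 'a set set) leq infty v"
      and Cv: "\<And>x y z. \<lbrakk>x \<in> carrier G; y \<in> carrier G; z \<in> carrier G\<rbrakk>
        \<Longrightarrow> C x y z \<longleftrightarrow> qless leq (v (x \<otimes> inv z)) (v (y \<otimes> inv z))"
    unfolding valuational_def by blast
  have "inv x \<preceq> x \<longleftrightarrow> \<not> C (inv x) x \<one>"
    using C x unfolding c_relation_of_def by blast
  also have "\<dots> \<longleftrightarrow> \<not> qless leq (v (inv x)) (v x)"
    using Cv[of "inv x" x \<one>] x by simp
  finally have iff: "inv x \<preceq> x \<longleftrightarrow> \<not> qless leq (v (inv x)) (v x)" .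
  have ord: "total_order_on (insert infty \<Gamma>) leq" "\<forall>\<gamma>\<in>\<Gamma>. qless leq \<gamma> infty"
    and ultra: "\<forall>g\<in>carrier G. \<forall>h\<in>carrier G. leq (v g) (v (g \<otimes> inv h)) \<or> leq (v h) (v (g \<otimes> inv h))"
    and fn: "v \<in> carrier G \<rightarrow> insert infty \<Gamma>" and v1: "\<forall>g\<in>carrier G. v g = infty \<longleftrightarrow> g = \<one>"
    using val unfolding valuation_def by blast+
  have refl: "leq a a" if "a \<in> insert infty \<Gamma>" for a
    using ord that unfolding total_order_on_def quasi_order_on_def reflp_on_def by blast
  have tr: "leq a c" if "a \<in> insert infty \<Gamma>" "b \<in> insert infty \<Gamma>" "c \<in> insert infty \<Gamma>" "leq a b" "leq b c"
    for a b c
    using ord that unfolding total_order_on_def quasi_order_on_def transp_on_def by blast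
  have top: "leq a infty" if "a \<in> insert infty \<Gamma>" for a
    using ord refl that by (auto simp: qless_def)
  have mem: "v x \<in> insert infty \<Gamma>" "v (inv x) \<in> insert infty \<Gamma>"
    using fn x by auto
  have "leq infty (v (inv x)) \<or> leq (v x) (v (inv x))"
    using ultra x v1 by (metis inv_closed l_one one_closed)
  then have "leq (v x) (v (inv x))"
    using tr[of "v x" infty "v (inv x)"] top mem by blast
  then show ?thesis using iff by (auto simp: qless_def qsim_def)
qed

text \<open>The o^+-type elements form the positive cone of a bi-invariant order. By
  \<open>final\<close> they lie above all other elements, which together with \<open>shift\<close>
  makes the cone closed under products.\<close>

lemma order_type_if_pos_final:
  assumes o: "\<And>x. \<lbrakk>x \<in> carrier G; x \<noteq> \<one>\<rbrakk> \<Longrightarrow> pos x \<or> pos (inv x)"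
    and final: "\<And>x y. \<lbrakk>x \<in> carrier G; y \<in> carrier G; y \<noteq> \<one>; pos x; x \<preceq> y\<rbrakk> \<Longrightarrow> pos y"
  shows "order_type G q"
proof -
  have ne: "x \<noteq> \<one>" if "pos x" for x using that not_pos_one by blast
  have asym: "\<not> (pos x \<and> pos (inv x))" if "x \<in> carrier G" for x
    using q_total[of x "inv x"] that by (auto simp: pos_def)
  have neg_below: "y \<lless> x" if "x \<in> carrier G" "y \<in> carrier G" "pos x" "\<not> pos y" for x y
    using final[of x y] q_one[of x] that ne by (cases "y = \<one>") auto
  have pos_mult: "pos (b \<otimes> a)" if ab: "a \<in> carrier G" "b \<in> carrier G" "pos a" "pos b" for a b
  proof -
    have "inv a \<lless> b" using neg_below[of b "inv a"] asym ab by auto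
    then have a: "a \<lless> b \<otimes> a" using shift[of "inv a" b] ab by simp
    then have "b \<otimes> a \<noteq> \<one>" using one_least ab by auto
    then show ?thesis using final[of a "b \<otimes> a"] q_le_if_below[OF _ _ a] ab by simp
  qed
  \<comment> \<open>Non-trivial elements outside the cone are therefore least among the non-trivial
    elements.\<close>
  have pos_if_below: "pos a" if ab: "a \<in> carrier G" "b \<in> carrier G" "b \<noteq> \<one>" "b \<lless> a" for a b
  proof (rule ccontr)
    assume n: "\<not> pos a"
    then have "inv b \<lless> a" using inv_below[of a b] ab by (simp add: pos_def)
    then show False using n o[of b] neg_below[of b a] neg_below[of "inv b" a] q_total[of a b]
        q_total[of a "inv b"] ab by auto
  qed
  \<comment> \<open>This is the order-type formula for C(a,b,1) with \<open>b\<close> non-trivial: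
    \<open>a\<close> exceeds both \<open>\<one>\<close> and \<open>b\<close> in the order given by
    the cone.\<close>
  have below_iff: "b \<lless> a \<longleftrightarrow> pos a \<and> pos (a \<otimes> inv b)"
    if ab: "a \<in> carrier G" "b \<in> carrier G" "b \<noteq> \<one>" for a b
  proof
    assume ba: "b \<lless> a"
    then have pa: "pos a" using pos_if_below ab by blast
    have "a \<otimes> inv b \<noteq> \<one>" using ba q_refl[of a] ab by (auto simp: inv_solve_right')
    moreover have "\<not> pos (inv (a \<otimes> inv b))"
    proof
      assume p: "pos (inv (a \<otimes> inv b))"
      then have "inv a \<lless> b \<otimes> inv a"
        using neg_below[of "b \<otimes> inv a" "inv a"] asym[of a] pa ab by (simp add: inv_mult_group)
      then have "a \<lless> b" using unshift[of "inv a" b] ab by simp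
      then show False using ba q_total ab by blast
    qed
    ultimately show "pos a \<and> pos (a \<otimes> inv b)" using pa o[of "a \<otimes> inv b"] ab by auto
  next
    assume p: "pos a \<and> pos (a \<otimes> inv b)"
    show "b \<lless> a"
    proof (cases "pos b")
      case True
      then have "inv b \<lless> a \<otimes> inv b" using neg_below asym p ab by simp
      then show ?thesis using unshift[of "inv b" a] ab by simp
    qed (use neg_below p ab in blast)
  qed
  define leq where "leq x y \<longleftrightarrow> x = y \<or> pos (y \<otimes> inv x)" for x y
  have less_iff: "qless leq x y \<longleftrightarrow> pos (y \<otimes> inv x)" if xy: "x \<in> carrier G" "y \<in> carrier G" for x y
    using asym[of "y \<otimes> inv x"] xy not_pos_one
    by (auto simp: qless_def qsim_def leq_def inv_mult_group)
  have trans: "leq x z"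
    if "x \<in> carrier G" "y \<in> carrier G" "z \<in> carrier G" "leq x y" "leq y z" for x y z
    using pos_mult[of "y \<otimes> inv x" "z \<otimes> inv y"] that by (auto simp: leq_def m_assoc)
  have total: "leq x y \<or> leq y x" if "x \<in> carrier G" "y \<in> carrier G" for x y
  proof (cases "y = x")
    case False
    then have "y \<otimes> inv x \<noteq> \<one>" using that by (simp add: inv_solve_right')
    then show ?thesis using o[of "y \<otimes> inv x"] that by (simp add: leq_def inv_mult_group) blast
  qed (simp add: leq_def)
  have anti: "x = y" if "x \<in> carrier G" "y \<in> carrier G" "leq x y" "leq y x" for x y
    using asym[of "y \<otimes> inv x"] that by (auto simp: leq_def inv_mult_group)
  have ord: "total_order_on (carrier G) leq"
    unfolding total_order_on_def quasi_order_on_def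
  proof (intro conjI)
    show "reflp_on (carrier G) leq" by (simp add: reflp_on_def leq_def)
    show "transp_on (carrier G) leq" unfolding transp_on_def using trans by blast
    show "totalp_on (carrier G) leq" unfolding totalp_on_def using total by blast
    show "antisymp_on (carrier G) leq" unfolding antisymp_on_def using anti by blast
  qed
  have inv: "leq (z \<otimes> x) (z \<otimes> y) \<and> leq (x \<otimes> z) (y \<otimes> z)"
    if xyz: "x \<in> carrier G" "y \<in> carrier G" "z \<in> carrier G" "leq x y" for x y z
  proof -
    have "pos (conj_by G z (y \<otimes> inv x)) \<longleftrightarrow> pos (y \<otimes> inv x)" using xyz by simp
    then show ?thesis using xyz by (auto simp: leq_def conj_by_def m_assoc inv_mult_group)
  qed
  have C: "x \<otimes> inv z \<preceq> y \<otimes> inv z \<longleftrightarrow> \<not> ((qless leq y x \<and> qless leq z x) \<or> (y = z \<and> z \<noteq> x))"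
    if xyz: "x \<in> carrier G" "y \<in> carrier G" "z \<in> carrier G" for x y z
  proof (cases "y = z")
    case True
    have "x \<otimes> inv z \<preceq> \<one> \<longleftrightarrow> x = z"
      using q_one[of "x \<otimes> inv z"] q_refl[of \<one>] xyz by (auto simp: inv_solve_right')
    then show ?thesis using True xyz not_pos_one by (auto simp: less_iff)
  next
    case False
    then have ne: "y \<otimes> inv z \<noteq> \<one>" using xyz by (auto simp: inv_solve_right')
    have "(x \<otimes> inv z) \<otimes> inv (y \<otimes> inv z) = x \<otimes> inv y"
      using xyz by (simp add: inv_mult_group m_assoc)
    then show ?thesis
      using False below_iff[of "x \<otimes> inv z" "y \<otimes> inv z"] ne xyz less_iff by auto
  qed
  have "\<forall>x\<in>carrier G. \<forall>y\<in>carrier G. \<forall>z\<in>carrier G. \<not> x \<otimes> inv z \<preceq> y \<otimes> inv z \<longleftrightarrow>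
      (qless leq y x \<and> qless leq z x) \<or> (y = z \<and> z \<noteq> x)"
    using C by blast
  moreover have "\<forall>x\<in>carrier G. \<forall>y\<in>carrier G. \<forall>z\<in>carrier G. leq x y \<longrightarrow>
      leq (z \<otimes> x) (z \<otimes> y) \<and> leq (x \<otimes> z) (y \<otimes> z)"
    using inv by blast
  ultimately show ?thesis
    using c_quasi_ordered_group_if_cqo_group[OF cqo_group_axioms] ord
    unfolding order_type_def by blast
qed

section \<open>The quotients G^\<gamma>/G_\<gamma> are of elementary type\<close>

lemma pos_crest_if_up_down:
  assumes g: "g \<in> carrier G" and u: "u \<in> up g" "u \<notin> down g"
  shows "u \<in> carrier G" "u \<noteq> \<one> \<longleftrightarrow> g \<noteq> \<one>" "pos (crest u) \<longleftrightarrow> pos (crest g)" "linked (crest u) (crest g)"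
proof -
  show G: "u \<in> carrier G" using u by (simp add: up_def)
  have "comp_le u g \<and> comp_le g u" using u by (auto simp: up_def down_def)
  then show l: "linked (crest u) (crest g)"
    using link_le_antisym[of "crest u" "crest g"] G g by (simp add: comp_le_def)
  show "u \<noteq> \<one> \<longleftrightarrow> g \<noteq> \<one>" "pos (crest u) \<longleftrightarrow> pos (crest g)"
    using linked_kind[OF _ _ l] G g by auto
qed

context
  fixes g
  assumes g: "g \<in> carrier G" "g \<noteq> \<one>"
begin

private abbreviation "U \<equiv> up g"
private abbreviation "L \<equiv> down g"
private abbreviation "H \<equiv> G\<lparr>carrier := up g\<rparr> Mod down g"
private abbreviation "Q \<equiv> induced_qo (down g) q"

lemma up_closed: "u \<in> U \<Longrightarrow> u \<in> carrier G"
  by (simp add: up_def)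

lemma down_closed: "u \<in> L \<Longrightarrow> u \<in> carrier G"
  by (simp add: down_def)

lemma group_up: "group (G\<lparr>carrier := U\<rparr>)"
  using subgroup_up subgroup.subgroup_is_group g is_group by blast

lemma inv_up: "u \<in> U \<Longrightarrow> inv\<^bsub>G\<lparr>carrier := U\<rparr>\<^esub> u = inv u"
  using m_inv_consistent subgroup_up g by blast

lemma down_normal: "L \<lhd> G\<lparr>carrier := U\<rparr>"
proof -
  have "subgroup L (G\<lparr>carrier := U\<rparr>)"
    using subgroup_incl subgroup_down subgroup_up down_subset_up g by blast
  moreover have "\<forall>x\<in>U. \<forall>h\<in>L. x \<otimes> h \<otimes> inv\<^bsub>G\<lparr>carrier := U\<rparr>\<^esub> x \<in> L"
    using conj_down g inv_up by (simp add: conj_by_def)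
  ultimately show ?thesis using group.normal_inv_iff[OF group_up] by simp
qed

lemma r_coset_up: "r_coset (G\<lparr>carrier := U\<rparr>) L u = L #> u"
  by (simp add: r_coset_def)

lemma quotient_group: "group H"
  using normal.factorgroup_is_group down_normal by blast

lemma quotient_carrier: "carrier H = (\<lambda>u. L #> u) ` U"
  by (auto simp: FactGroup_def RCOSETS_def r_coset_up)

lemma quotient_one: "\<one>\<^bsub>H\<^esub> = L"
  by (simp add: FactGroup_def)

lemma quotient_mult: "\<lbrakk>u \<in> U; w \<in> U\<rbrakk> \<Longrightarrow> (L #> u) \<otimes>\<^bsub>H\<^esub> (L #> w) = L #> (u \<otimes> w)"
  using normal.rcos_sum[OF down_normal, of u w] by (simp add: FactGroup_def r_coset_up)

lemma quotient_inv: "u \<in> U \<Longrightarrow> inv\<^bsub>H\<^esub> (L #> u) = L #> inv u"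
  using normal.inv_FactGroup[OF down_normal, of "L #> u"] normal.rcos_inv[OF down_normal, of u]
    quotient_carrier inv_up by (simp add: r_coset_up)

lemma up_subgroup_rules:
  shows "\<one> \<in> U" "u \<in> U \<Longrightarrow> inv u \<in> U" "\<lbrakk>u \<in> U; w \<in> U\<rbrakk> \<Longrightarrow> u \<otimes> w \<in> U"
  using subgroup_up[OF g(1)]
  by (simp_all add: subgroup.one_closed subgroup.m_inv_closed subgroup.m_closed)

lemma down_subgroup_rules:
  shows "\<one> \<in> L" "u \<in> L \<Longrightarrow> inv u \<in> L" "\<lbrakk>u \<in> L; w \<in> L\<rbrakk> \<Longrightarrow> u \<otimes> w \<in> L"
  using subgroup_down[OF g]
  by (simp_all add: subgroup.one_closed subgroup.m_inv_closed subgroup.m_closed)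

lemma quotient_conj:
  "\<lbrakk>z \<in> U; u \<in> U\<rbrakk> \<Longrightarrow> conj_by H (L #> z) (L #> u) = L #> conj_by G z u"
  unfolding conj_by_def by (simp add: quotient_mult quotient_inv up_subgroup_rules del: mult_FactGroup)

lemma mem_down_coset_iff:
  assumes "x \<in> L" "u \<in> U" shows "x \<otimes> u \<in> L \<longleftrightarrow> u \<in> L"
proof
  assume "x \<otimes> u \<in> L"
  then have "inv x \<otimes> (x \<otimes> u) \<in> L" using assms down_subgroup_rules by blast
  then show "u \<in> L" using assms up_closed down_closed by simp
qed (use assms down_subgroup_rules in blast)

lemma coset_eq_down_iff:
  assumes u: "u \<in> U" shows "L #> u = L \<longleftrightarrow> u \<in> L"
proof
  assume "L #> u = L"
  moreover have "\<one> \<otimes> u \<in> L #> u" using down_subgroup_rules(1) by (auto simp: r_coset_def)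
  ultimately show "u \<in> L" using u up_closed by simp
next
  assume "u \<in> L" then show "L #> u = L" using coset_join2 subgroup_down g down_closed by blast
qed

text \<open>All members of a non-trivial coset are thus equivalent, which makes the induced
  quasi-order independent of representatives.\<close>

lemma mult_down_equiv:
  assumes "x \<in> L" "u \<in> U" "u \<notin> L"
  shows "x \<otimes> u \<preceq> u" "u \<preceq> x \<otimes> u"
proof -
  have G: "x \<in> carrier G" "u \<in> carrier G" using assms up_closed down_closed by auto
  have "comp_less x u"
    using assms comp_le_trans[of g u x] G g by (auto simp: up_def down_def)
  then show "x \<otimes> u \<preceq> u" "u \<preceq> x \<otimes> u" using q_equiv_mult_small G by auto
qed

lemma induced_qo_coset_iff:
  assumes uw: "u \<in> U" "w \<in> U"
  shows "Q (L #> u) (L #> w) \<longleftrightarrow> u \<in> L \<or> (w \<notin> L \<and> u \<preceq> w)"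
proof -
  have *: "x \<otimes> u \<preceq> y \<otimes> w \<longleftrightarrow> u \<preceq> w" if "x \<in> L" "y \<in> L" "u \<notin> L" "w \<notin> L" for x y
  proof -
    have G: "x \<in> carrier G" "y \<in> carrier G" "u \<in> carrier G" "w \<in> carrier G"
      "x \<otimes> u \<in> carrier G" "y \<otimes> w \<in> carrier G"
      using that uw up_closed down_closed by auto
    note e = mult_down_equiv[OF that(1) uw(1) that(3)] mult_down_equiv[OF that(2) uw(2) that(4)]
    show ?thesis
      using q_trans[OF G(5,3,6)] q_trans[OF G(3,4,6)] q_trans[OF G(3,5,4)] q_trans[OF G(5,6,4)] e
      by satx
  qed
  have "Q (L #> u) (L #> w) \<longleftrightarrow>
      (\<exists>x\<in>L. \<exists>y\<in>L. x \<otimes> u \<in> L \<or> (y \<otimes> w \<notin> L \<and> x \<otimes> u \<preceq> y \<otimes> w))"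
    by (auto simp: induced_qo_def r_coset_def)
  also have "\<dots> \<longleftrightarrow> (\<exists>x\<in>L. \<exists>y\<in>L. u \<in> L \<or> (w \<notin> L \<and> u \<preceq> w))"
    using * mem_down_coset_iff[OF _ uw(1)] mem_down_coset_iff[OF _ uw(2)] by (intro bex_cong) auto
  also have "\<dots> \<longleftrightarrow> u \<in> L \<or> (w \<notin> L \<and> u \<preceq> w)"
    using down_subgroup_rules(1) by blast
  finally show ?thesis .
qed

lemma quotient_cqo_group: "cqo_group H Q"
proof (rule cqo_group.intro[OF quotient_group], unfold_locales)
  fix A assume "A \<in> carrier H"
  then show "Q A A" using q_refl up_closed by (auto simp: quotient_carrier induced_qo_coset_iff)
next
  fix A B D assume *: "A \<in> carrier H" "B \<in> carrier H" "D \<in> carrier H" "Q A B" "Q B D"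
  then obtain a b d where abd: "a \<in> U" "b \<in> U" "d \<in> U" "A = L #> a" "B = L #> b" "D = L #> d"
    by (auto simp: quotient_carrier)
  then show "Q A D" using * q_trans[of a b d] up_closed by (auto simp: induced_qo_coset_iff)
next
  fix A B assume *: "A \<in> carrier H" "B \<in> carrier H"
  then obtain a b where "a \<in> U" "b \<in> U" "A = L #> a" "B = L #> b"
    by (auto simp: quotient_carrier)
  then show "Q A B \<or> Q B A" using q_total[of a b] up_closed by (auto simp: induced_qo_coset_iff)
next
  fix A assume A: "A \<in> carrier H" "Q A \<one>\<^bsub>H\<^esub>"
  then obtain a where a: "a \<in> U" "A = L #> a" by (auto simp: quotient_carrier)
  have "L = L #> \<one>" using coset_eq_down_iff down_subgroup_rules up_subgroup_rules by blast
  then have "Q (L #> a) (L #> \<one>)" using A a quotient_one by simp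
  then have "a \<in> L" using a induced_qo_coset_iff down_subgroup_rules up_subgroup_rules by blast
  then show "A = \<one>\<^bsub>H\<^esub>" using a coset_eq_down_iff quotient_one by simp
next
  fix A B assume AB: "A \<in> carrier H" "B \<in> carrier H" "\<not> Q B A"
  then obtain a b where ab: "a \<in> U" "b \<in> U" "A = L #> a" "B = L #> b"
    by (auto simp: quotient_carrier)
  have G: "a \<in> carrier G" "b \<in> carrier G" using ab up_closed by auto
  have n: "b \<notin> L" "a \<in> L \<or> a \<lless> b" using AB ab by (auto simp: induced_qo_coset_iff)
  have bU: "b \<otimes> inv a \<in> U" using ab up_subgroup_rules by blast
  have b: "b \<otimes> inv a \<otimes> a = b" using G by (simp add: m_assoc)
  \<comment> \<open>Otherwise \<open>a\<close> and \<open>b\<close> would represent the same coset,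
    so both would be in \<open>down g\<close> or they would be equivalent.\<close>
  have bL: "b \<otimes> inv a \<notin> L"
  proof
    assume c: "b \<otimes> inv a \<in> L"
    show False
    proof (cases "a \<in> L")
      case True
      then show False using down_subgroup_rules(3)[OF c, of a] n b by simp
    next
      case False
      then show False using mult_down_equiv(1)[OF c ab(1)] n b by simp
    qed
  qed
  have "inv a \<in> L \<or> inv a \<lless> b \<otimes> inv a" using n down_subgroup_rules shift G by blast
  then have "\<not> Q (L #> (b \<otimes> inv a)) (L #> inv a)"
    using bL bU ab up_subgroup_rules by (auto simp: induced_qo_coset_iff)
  then show "\<not> Q (B \<otimes>\<^bsub>H\<^esub> inv\<^bsub>H\<^esub> A) (inv\<^bsub>H\<^esub> A)"
    using ab by (simp add: quotient_mult quotient_inv up_subgroup_rules del: mult_FactGroup)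
next
  fix A B Z assume ABZ: "A \<in> carrier H" "B \<in> carrier H" "Z \<in> carrier H" "\<not> Q B A"
  then obtain a b z where ab: "a \<in> U" "b \<in> U" "z \<in> U" "A = L #> a" "B = L #> b" "Z = L #> z"
    by (auto simp: quotient_carrier)
  have G: "a \<in> carrier G" "b \<in> carrier G" "z \<in> carrier G" using ab up_closed by auto
  have n: "b \<notin> L" "a \<in> L \<or> a \<lless> b" using ABZ ab by (auto simp: induced_qo_coset_iff)
  have conj_L: "conj_by G z x \<in> L \<longleftrightarrow> x \<in> L" if "x \<in> U" for x
    using conj_down[OF g, of z x] conj_down[OF g, of "inv z" "conj_by G z x"] that ab G
      up_closed up_subgroup_rules by auto
  have conj_U: "conj_by G z x \<in> U" if "x \<in> U" for x
    using that ab up_subgroup_rules by (simp add: conj_by_def)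
  show "\<not> Q (conj_by H Z B) (conj_by H Z A)"
    using ab n G by (auto simp: quotient_conj induced_qo_coset_iff conj_L conj_U)
qed

text \<open>Elements of \<open>up g\<close> outside \<open>down g\<close> have crests of the same
  kind as \<open>crest g\<close>, so they are v-type as soon as \<open>crest g\<close> is not
  o^+-type.\<close>

lemma valuational_quotient_iff: "valuational H Q \<longleftrightarrow> \<not> pos (crest g)"
proof
  assume val: "valuational H Q"
  \<comment> \<open>In a valuational quotient every element is v-type; for the coset of
    \<open>?c\<close> this says \<open>crest g \<preceq> ?c\<close>.\<close>
  let ?c = "inv (crest g)"
  have c: "crest g \<in> U" "crest g \<notin> L" "?c \<in> U" "?c \<notin> L"
    using g comp_le_refl by (auto simp: up_def down_def)
  then have "L #> ?c \<in> carrier H" by (auto simp: quotient_carrier)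
  then have "Q (inv\<^bsub>H\<^esub> (L #> ?c)) (L #> ?c)"
    using cqo_group.v_type_if_valuational[OF quotient_cqo_group val] by blast
  then have "crest g \<preceq> ?c"
    using c g by (simp add: quotient_inv induced_qo_coset_iff)
  then show "\<not> pos (crest g)" by (simp add: pos_def)
next
  assume n: "\<not> pos (crest g)"
  show "valuational H Q"
  proof (rule cqo_group.valuational_if_v_type[OF quotient_cqo_group])
    fix A assume "A \<in> carrier H"
    then obtain a where a: "a \<in> U" "A = L #> a" by (auto simp: quotient_carrier)
    have "inv a \<preceq> a" if "a \<notin> L"
    proof -
      have "crest a \<preceq> inv (crest a)" "a \<in> carrier G"
        using pos_crest_if_up_down[OF g(1) a(1) that] n crest_not_pos by auto
      then show ?thesis using crest_cases[of a] inv_crest_le[of a] by auto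
    qed
    moreover have "inv a \<in> L" if "a \<in> L" using that down_subgroup_rules by blast
    moreover have "a \<in> L" if "inv a \<in> L"
      using down_subgroup_rules(2)[OF that] a up_closed by simp
    ultimately show "Q (inv\<^bsub>H\<^esub> A) A"
      using a by (auto simp: quotient_inv induced_qo_coset_iff up_subgroup_rules)
  qed
qed

text \<open>Every crest outside \<open>down g\<close> is now o^+-type, so each non-trivial coset or
  its inverse is o^+-type, and \<open>order_type_if_pos_final\<close> applies once the positive
  cosets are seen to be final.\<close>

lemma order_type_quotient_if:
  assumes p: "pos (crest g)"
  shows "order_type H Q"
proof (rule cqo_group.order_type_if_pos_final[OF quotient_cqo_group])
  have pos_iff: "cqo_group.pos H Q (L #> a) \<longleftrightarrow> a \<notin> L \<and> pos a" if a: "a \<in> U" for a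
  proof -
    have "a \<in> L" if "inv a \<in> L"
      using down_subgroup_rules(2)[OF that] a up_closed by simp
    then show ?thesis
      using a up_subgroup_rules
      by (auto simp: cqo_group.pos_def[OF quotient_cqo_group] quotient_inv induced_qo_coset_iff pos_def)
  qed
  have pos_or: "pos a \<or> pos (inv a)" if "a \<in> U" "a \<notin> L" for a
    using pos_crest_if_up_down(3)[OF g(1) that] p crest_cases[of a] by auto
  show "cqo_group.pos H Q A \<or> cqo_group.pos H Q (inv\<^bsub>H\<^esub> A)"
    if A: "A \<in> carrier H" "A \<noteq> \<one>\<^bsub>H\<^esub>" for A
  proof -
    obtain a where a: "a \<in> U" "A = L #> a" using A by (auto simp: quotient_carrier)
    have n: "a \<notin> L" using A a quotient_one coset_eq_down_iff by simp
    then have "inv a \<notin> L" using down_subgroup_rules(2)[of "inv a"] a up_closed by auto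
    then show ?thesis using pos_or[OF a(1) n] n a by (auto simp: quotient_inv pos_iff up_subgroup_rules)
  qed
  show "cqo_group.pos H Q B"
    if AB: "A \<in> carrier H" "B \<in> carrier H" "B \<noteq> \<one>\<^bsub>H\<^esub>" "cqo_group.pos H Q A" "Q A B" for A B
  proof -
    obtain a b where ab: "a \<in> U" "b \<in> U" "A = L #> a" "B = L #> b"
      using AB by (auto simp: quotient_carrier)
    have a: "a \<notin> L" "pos a" using AB ab pos_iff by auto
    have b: "b \<notin> L" using AB ab quotient_one coset_eq_down_iff by simp
    have le: "a \<preceq> b" using AB ab a by (auto simp: induced_qo_coset_iff)
    have G: "a \<in> carrier G" "b \<in> carrier G" using ab up_closed by auto
    have "linked (crest a) (crest b)"
      using pos_crest_if_up_down(4)[OF g(1) ab(1) a(1)] pos_crest_if_up_down(4)[OF g(1) ab(2) b]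
        linked_sym[of "crest b" "crest g"] linked_trans[of "crest a" "crest g" "crest b"] G g by auto
    then have "linked a (crest b)" using crest_pos a G by simp
    \<comment> \<open>Finality: \<open>b\<close> lies between \<open>a\<close>, which is its own
      crest, and the crest of \<open>b\<close>, and these two are linked.\<close>
    moreover have "between q a (crest b) b" using le le_crest G by (simp add: between_def)
    ultimately have "pos b" using linkedD[of a "crest b" b] G a by blast
    then show ?thesis using pos_iff ab b by simp
  qed
qed

lemma elementary_type_quotient: "elementary_type H Q"
  using valuational_quotient_iff order_type_quotient_if unfolding elementary_type_def by blast

end

text \<open>As the crests are not linked, some element between them differs in kind. It lies above
  the non-trivial \<open>crest a\<close>, so it is o^+-type; hence it is its own crest and neither
  linked nor equivalent to the two given crests.\<close>

lemma comp_less_pos_between: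
  assumes ab: "a \<in> carrier G" "b \<in> carrier G" "a \<noteq> \<one>" and less: "comp_less a b"
    and np: "\<not> pos (crest a)" "\<not> pos (crest b)"
  obtains k where "k \<in> carrier G" "k \<noteq> \<one>" "pos (crest k)" "comp_less a k" "comp_less k b"
proof -
  have le: "crest a \<lless> crest b" using comp_less_crestD less ab by blast
  have "\<not> linked (crest b) (crest a)" using less by (simp add: comp_le_def link_le_def)
  then have "\<not> linked (crest a) (crest b)" using linked_sym ab crest_closed by blast
  then obtain k where k: "k \<in> carrier G" "between q (crest a) (crest b) k"
    "\<not> ((k = \<one> \<longleftrightarrow> crest a = \<one>) \<and> (pos k \<longleftrightarrow> pos (crest a)))"
    unfolding linked_def by blast
  have akb: "crest a \<preceq> k" "k \<preceq> crest b"
    using k(2) le q_trans[of "crest b" k "crest a"] ab k(1) by (auto simp: between_def)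
  have k1: "k \<noteq> \<one>" using akb q_one[of "crest a"] ab by auto
  then have pk: "pos k" using k ab np by auto
  have "\<not> linked k (crest a)" "\<not> linked (crest b) k"
    using linked_kind[of k "crest a"] linked_kind[of "crest b" k] pk np ab k(1) by auto
  moreover have "\<not> k \<preceq> crest a" "\<not> crest b \<preceq> k"
    using pos_cong[of k "crest a"] pos_cong[of k "crest b"] akb pk np ab k(1) by auto
  ultimately have "comp_less a k" "comp_less k b"
    using crest_pos[OF pk k(1)] by (simp_all add: comp_le_def link_le_def)
  then show ?thesis using that k(1) k1 pk crest_pos[OF pk k(1)] by simp
qed

section \<open>The lifting of the quotients is a C-quasi-order\<close>

abbreviation lift :: "'a \<Rightarrow> 'a \<Rightarrow> bool" where
  "lift \<equiv> lifted_qo G (type_values G q) (type_le_rev q) (type_component G q)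
     (\<lambda>\<gamma>. induced_qo (val_gt G (type_le_rev q) (type_component G q) \<gamma>) q)"

text \<open>Non-trivial \<open>g\<close> and \<open>h\<close> of equal value lie outside
  \<open>down g\<close>, where the induced quasi-order agrees with \<open>\<preceq>\<close>; so the
  lifting is lexicographic.\<close>

lemma lift_iff:
  assumes gh: "g \<in> carrier G" "h \<in> carrier G"
  shows "lift g h \<longleftrightarrow> comp_le g h \<and> (comp_le h g \<longrightarrow> g \<preceq> h)"
proof -
  let ?D = "\<lambda>\<gamma>. val_gt G (type_le_rev q) (type_component G q) \<gamma>"
  let ?E = "\<exists>\<gamma>\<in>type_values G q. type_component G q g = \<gamma> \<and> type_component G q h = \<gamma> \<and>
      induced_qo (?D \<gamma>) q (?D \<gamma> #> g) (?D \<gamma> #> h)"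
  have E: "?E \<longleftrightarrow> comp_le g h \<and> comp_le h g \<and> g \<noteq> \<one> \<and> g \<preceq> h"
  proof (cases "comp_le g h \<and> comp_le h g \<and> g \<noteq> \<one>")
    case True
    then have eq: "type_component G q h = type_component G q g"
      using type_component_eq_iff gh by blast
    have mem: "type_component G q g \<in> type_values G q"
      using True gh by (auto simp: type_values_def)
    have "g \<in> up g" "h \<in> up g" "g \<notin> down g" "h \<notin> down g"
      using True gh comp_le_refl by (auto simp: up_def down_def)
    then have "induced_qo (down g) q (down g #> g) (down g #> h) \<longleftrightarrow> g \<preceq> h"
      using induced_qo_coset_iff[of g g h] True gh by blast
    then show ?thesis using True eq mem val_gt_eq_down[OF gh(1)] by auto
  next
    case False
    have "comp_le g h \<and> comp_le h g \<and> g \<noteq> \<one>"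
      if "type_component G q g = type_component G q h" "type_component G q g \<in> type_values G q"
    proof -
      have "g \<noteq> \<one>"
        using that(2) valuation_type_component type_component_one
        unfolding valuation_def by metis
      then show ?thesis using that(1) type_component_eq_iff gh by blast
    qed
    then show ?thesis using False by metis
  qed
  have h1: "h = \<one>" if "comp_le h g" "g = \<one>" using that comp_le_one_iff gh by blast
  have tot: "comp_le g h \<or> comp_le h g" using comp_le_total gh by blast
  have one: "comp_le g h \<and> comp_le h g \<and> g \<preceq> h" if "g = \<one>" "h = \<one>"
    using that q_refl comp_le_refl by simp
  show ?thesis
    unfolding lifted_qo_def E qless_type_le_rev_iff[OF gh] using h1 tot one by satx
qed

lemma q_if_lift: "\<lbrakk>g \<in> carrier G; h \<in> carrier G; lift g h\<rbrakk> \<Longrightarrow> g \<preceq> h"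
  using q_le_if_comp_less lift_iff by blast

lemma not_lift_iff:
  "\<lbrakk>g \<in> carrier G; h \<in> carrier G\<rbrakk> \<Longrightarrow> \<not> lift h g \<longleftrightarrow> comp_less g h \<or> (comp_le g h \<and> comp_le h g \<and> g \<lless> h)"
  using lift_iff[of h g] comp_le_total[of g h] by blast

lemma lift_cqo_group: "cqo_group G lift"
proof (rule cqo_group.intro[OF is_group], unfold_locales)
  fix x assume x: "x \<in> carrier G"
  show "lift x x" using lift_iff[OF x x] q_refl[OF x] comp_le_refl[OF x] by blast
next
  fix x y z assume *: "x \<in> carrier G" "y \<in> carrier G" "z \<in> carrier G" "lift x y" "lift y z"
  have xy: "comp_le x y" "comp_le y x \<longrightarrow> x \<preceq> y" using *(4) lift_iff[OF *(1,2)] by auto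
  have yz: "comp_le y z" "comp_le z y \<longrightarrow> y \<preceq> z" using *(5) lift_iff[OF *(2,3)] by auto
  have "comp_le x z" using comp_le_trans[OF *(1-3)] xy yz by blast
  moreover have "x \<preceq> z" if "comp_le z x"
    using comp_le_trans[OF *(2,3,1) yz(1) that] comp_le_trans[OF *(3,1,2) that xy(1)] xy yz
      q_trans[OF *(1-3)] by blast
  ultimately show "lift x z" using lift_iff[OF *(1,3)] by blast
next
  fix x y assume *: "x \<in> carrier G" "y \<in> carrier G"
  show "lift x y \<or> lift y x"
    using lift_iff[OF *] lift_iff[OF *(2,1)] comp_le_total[OF *] q_total[OF *] by blast
next
  fix x assume x: "x \<in> carrier G" "lift x \<one>"
  then show "x = \<one>" using q_if_lift[of x \<one>] q_one by simp
next
  fix a b assume ab: "a \<in> carrier G" "b \<in> carrier G" "\<not> lift b a"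
  let ?c = "b \<otimes> inv a"
  have c: "?c \<in> carrier G" "?c \<otimes> a = b" using ab by (simp_all add: m_assoc)
  have b_max: "comp_le b ?c \<or> comp_le b a" using comp_le_mult_max[of ?c a] ab c by simp
  consider "comp_less a b" | "comp_le a b" "comp_le b a" "a \<lless> b"
    using not_lift_iff[OF ab(1,2)] ab(3) by blast
  \<comment> \<open>In the first case, the ultrametric inequality for
    \<open>b = ?c \<otimes> a\<close> bounds the value of \<open>?c\<close> by that of
    \<open>b\<close>, which is below that of \<open>a\<close>.\<close>
  then have "comp_less (inv a) ?c \<or> (comp_le (inv a) ?c \<and> inv a \<lless> ?c)"
  proof cases
    case 1
    then have "comp_le b ?c" using b_max by blast
    then have "comp_less a ?c" using 1 comp_le_trans[of b ?c a] ab c by blast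
    then show ?thesis using ab c by simp
  next
    case 2
    \<comment> \<open>If \<open>?c\<close> had a larger value than \<open>a\<close>, then
      \<open>b = ?c \<otimes> a\<close> would be equivalent to \<open>a\<close>.\<close>
    have "comp_le a ?c"
    proof (rule ccontr)
      assume "comp_less ?c a"
      then have "?c \<otimes> a \<preceq> a" using q_equiv_mult_small[of ?c a] ab c by simp
      then show False using 2 c by simp
    qed
    then show ?thesis using shift[OF ab(1,2)] 2 ab c by simp
  qed
  then have "comp_less (inv a) ?c \<or> (comp_le (inv a) ?c \<and> comp_le ?c (inv a) \<and> inv a \<lless> ?c)"
    by blast
  then show "\<not> lift ?c (inv a)" using not_lift_iff[of "inv a" ?c] ab(1) c(1) by blast
next
  fix a b z assume ab: "a \<in> carrier G" "b \<in> carrier G" "z \<in> carrier G" "\<not> lift b a"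
  have "lift (conj_by G z b) (conj_by G z a) \<longleftrightarrow> lift b a"
    using lift_iff[of "conj_by G z b" "conj_by G z a"] lift_iff[of b a] ab(1-3) by simp
  then show "\<not> lift (conj_by G z b) (conj_by G z a)" using ab by blast
qed

section \<open>Welding recovers the original quasi-order\<close>

definition weld_points :: "'a set" where
  "weld_points = {g \<in> carrier G. g \<lless> inv g \<and>
     (\<exists>m\<in>carrier G. v_type G q m \<and> m \<preceq> g \<and> g \<preceq> m)}"

text \<open>Lifting puts \<open>m\<close> strictly below \<open>g\<close>, since
  \<open>inv g\<close> is o^+-type and \<open>m\<close> is not. If \<open>h\<close> and
  \<open>inv h\<close> are below \<open>g\<close>, they are below the equivalent \<open>m\<close>,
  so \<open>h\<close> has at least the value of \<open>m\<close>; hence \<open>m\<close> is a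
  maximum, and every other maximum lies between \<open>m\<close> and \<open>g\<close> for
  \<open>\<preceq>\<close>.\<close>

lemma weld_max_lift:
  assumes g: "g \<in> carrier G" "g \<lless> inv g"
    and m: "m \<in> carrier G" "v_type G q m" "m \<preceq> g" "g \<preceq> m"
  shows "m \<in> weld_max G lift g"
    and "s \<in> weld_max G lift g \<Longrightarrow> s \<in> carrier G \<and> s \<preceq> g \<and> g \<preceq> s"
proof -
  have cm: "crest m = m" "\<not> pos m" using m by (auto simp: crest_def v_type_def qsim_def pos_def)
  have cg: "crest g = inv g" "pos (inv g)" using g by (simp_all add: crest_def pos_def)
  have "\<not> linked (inv g) m" using linked_kind[of "inv g" m] cm cg g m by auto
  moreover have "\<not> inv g \<preceq> m" using q_trans[of "inv g" m g] g m by auto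
  ultimately have less: "comp_less m g" by (simp add: comp_le_def link_le_def cm cg)
  then have le: "comp_le m g" using comp_less_imp_le m g by blast
  have mg: "lift m g" "lift (inv m) g"
    using lift_iff[of m g] lift_iff[of "inv m" g] less le m g by auto
  have max: "lift h m" if h: "h \<in> carrier G" "lift h g" "lift (inv h) g" for h
  proof -
    have hg: "h \<preceq> g" "inv h \<preceq> g" using q_if_lift h g by auto
    then have hm: "h \<preceq> m" "inv h \<preceq> m"
      using q_trans[of h g m] q_trans[of "inv h" g m] h g m by auto
    then have "crest h \<preceq> crest m" using crest_cases[of h] cm by auto
    then show ?thesis using comp_le_if_crest_le hm lift_iff[of h m] h m by blast
  qed
  show "m \<in> weld_max G lift g"
    using mg max m by (simp add: weld_max_def qmax_def)
  show "s \<in> carrier G \<and> s \<preceq> g \<and> g \<preceq> s" if s: "s \<in> weld_max G lift g"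
  proof -
    have sG: "s \<in> carrier G" "lift s g" "lift m s"
      using s mg m by (auto simp: weld_max_def qmax_def)
    then have "s \<preceq> g" "m \<preceq> s" using q_if_lift g m by auto
    then show ?thesis using q_trans[of g m s] sG g m by blast
  qed
qed

lemma weldable_weld_points:
  assumes "g \<in> weld_points"
  shows "weldable G lift g"
proof -
  obtain m where g: "g \<in> carrier G" "g \<lless> inv g"
    and m: "m \<in> carrier G" "v_type G q m" "m \<preceq> g" "g \<preceq> m"
    using assms by (auto simp: weld_points_def)
  have "g \<preceq> inv g" using q_le_if_below g by simp
  then have "lift g (inv g)" "\<not> lift (inv g) g"
    using lift_iff[of g "inv g"] lift_iff[of "inv g" g] g comp_le_refl by auto
  then have "o_minus G lift g" by (simp add: o_minus_def qless_def qsim_def)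
  then show ?thesis using weld_max_lift(1)[OF g m] g by (auto simp: weldable_def)
qed

text \<open>Required because \<open>weld\<close> acts at all conjugates of a given point.\<close>

lemma conj_weld_points:
  assumes "g \<in> weld_points" "z \<in> carrier G"
  shows "conj_by G z g \<in> weld_points"
proof -
  obtain m where g: "g \<in> carrier G" "g \<lless> inv g"
    and m: "m \<in> carrier G" "v_type G q m" "m \<preceq> g" "g \<preceq> m"
    using assms by (auto simp: weld_points_def)
  have "v_type G q (conj_by G z m)" using m assms by (simp add: v_type_def qsim_def)
  then show ?thesis using g m assms unfolding weld_points_def by force
qed

lemma q_if_weld_step:
  assumes g: "g \<in> weld_points"
    and xy: "x \<in> weld_max G lift g \<union> qclass G lift g" "y \<in> weld_max G lift g \<union> qclass G lift g"
  shows "x \<preceq> y"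
proof -
  obtain m where gG: "g \<in> carrier G" "g \<lless> inv g"
    and m: "m \<in> carrier G" "v_type G q m" "m \<preceq> g" "g \<preceq> m"
    using g by (auto simp: weld_points_def)
  have *: "s \<in> carrier G \<and> s \<preceq> g \<and> g \<preceq> s" if "s \<in> weld_max G lift g \<union> qclass G lift g" for s
    using that
  proof
    assume "s \<in> qclass G lift g"
    then have "s \<in> carrier G" "lift s g" "lift g s" by (auto simp: qclass_def qsim_def)
    then show ?thesis using q_if_lift gG by blast
  qed (rule weld_max_lift(2)[OF gG m])
  show ?thesis using *[OF xy(1)] *[OF xy(2)] q_trans[of x g y] gG by blast
qed

text \<open>Here \<open>y\<close> has a larger value than \<open>x\<close>, so \<open>x\<close> and
  \<open>y\<close> are equivalent. If \<open>crest x \<preceq> x\<close>, the crests would compare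
  the wrong way, so \<open>x\<close> is o^--type. A separator \<open>k\<close> that is not o^+-type
  satisfies \<open>k \<preceq> x\<close> by \<open>inv_below\<close>; it is therefore equivalent to
  \<open>crest y\<close>, and \<open>y\<close> is v-type.\<close>

lemma weld_point_if_not_lift:
  assumes xy: "x \<in> carrier G" "y \<in> carrier G" "x \<preceq> y" "\<not> lift x y"
  shows "x \<in> weld_points" "y \<in> weld_max G lift x"
proof -
  have less: "comp_less y x" using not_lift_iff[of y x] xy by blast
  have yx: "y \<preceq> x" using q_le_if_comp_less less xy by blast
  have nc: "\<not> crest x \<preceq> x"
  proof
    assume "crest x \<preceq> x"
    then have "crest x \<preceq> y" using q_trans[of "crest x" x y] xy by simp
    then have "crest x \<preceq> crest y" using q_trans[of "crest x" y "crest y"] le_crest xy by simp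
    then show False using less comp_le_if_crest_le by blast
  qed
  then have cx: "crest x = inv x" using crest_cases[of x] q_refl xy by auto
  then have ox: "x \<lless> inv x" using nc by simp
  obtain k where k: "k \<in> carrier G" "\<not> pos k" "crest y \<preceq> k" "k \<preceq> crest x"
    using comp_less_separator less xy by blast
  have "k \<preceq> x"
  proof (rule ccontr)
    assume "\<not> k \<preceq> x"
    then have "inv x \<lless> k" using inv_below[of k x] k xy by (simp add: pos_def)
    then show False using k cx by simp
  qed
  then have "k \<preceq> y" using q_trans[of k x y] k xy by blast
  then have "k \<preceq> crest y" using q_trans[of k y "crest y"] le_crest k xy by simp
  then have "\<not> pos (crest y)" using pos_cong[of k "crest y"] k xy by simp
  then have v: "v_type G q y"
    using crest_not_pos[of y] inv_crest_le[of y] crest_cases[of y] xy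
    by (auto simp: v_type_def qsim_def)
  show "x \<in> weld_points" using v ox xy yx by (auto simp: weld_points_def)
  show "y \<in> weld_max G lift x" using weld_max_lift(1)[OF xy(1) ox xy(2) v] yx xy by blast
qed

text \<open>Each step of the transitive closure stays within \<open>\<preceq>\<close>, and
  conversely a single step, by lifting or by welding at \<open>x\<close>, reaches every
  \<open>y\<close> above \<open>x\<close>.\<close>

lemma weld_lift_iff:
  assumes xy: "x \<in> carrier G" "y \<in> carrier G"
  shows "weld G lift weld_points x y \<longleftrightarrow> x \<preceq> y"
proof
  assume "weld G lift weld_points x y"
  then have "y \<in> carrier G \<and> x \<preceq> y"
    unfolding weld_def
  proof (induction rule: tranclp_induct)
    case (base y)
    then show ?case using q_if_lift[of x y] q_if_weld_step[of _ x y] conj_weld_points by blast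
  next
    case (step y z)
    then have "y \<in> carrier G" "z \<in> carrier G" "x \<preceq> y" by auto
    moreover from step have "y \<preceq> z"
      using q_if_lift[of y z] q_if_weld_step[of _ y z] conj_weld_points by blast
    ultimately show ?case using q_trans[of x y z] xy by blast
  qed
  then show "x \<preceq> y" by blast
next
  assume le: "x \<preceq> y"
  show "weld G lift weld_points x y"
  proof (cases "lift x y")
    case True
    then show ?thesis unfolding weld_def using xy by blast
  next
    case False
    note w = weld_point_if_not_lift[OF xy le False]
    have "conj_by G \<one> x = x" using xy by (simp add: conj_by_def)
    moreover have "x \<in> qclass G lift x"
      using lift_iff[of x x] q_refl comp_le_refl xy by (auto simp: qclass_def qsim_def)
    ultimately have "\<exists>g\<in>weld_points. \<exists>z\<in>carrier G.
         x \<in> weld_max G lift (conj_by G z g) \<union> qclass G lift (conj_by G z g) \<and>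
         y \<in> weld_max G lift (conj_by G z g) \<union> qclass G lift (conj_by G z g)"
      using w by (metis UnI1 UnI2 one_closed)
    then show ?thesis unfolding weld_def using xy by blast
  qed
qed

end

section \<open>Decomposition of a C-quasi-order by its type-valuation\<close>

theorem theorem3p39:
  fixes G :: "('a, 'm) monoid_scheme" and q :: "'a \<Rightarrow> 'a \<Rightarrow> bool"
  assumes "c_quasi_ordered_group G q"
  shows
    "let \<Gamma> = type_values G q;
         leq = type_le_rev q;
         v = type_component G q;
         U = val_ge G leq v;
         L = val_gt G leq v;
         H = (\<lambda>\<gamma>. (G\<lparr>carrier := U \<gamma>\<rparr>) Mod L \<gamma>);
         Q = (\<lambda>\<gamma>. induced_qo (L \<gamma>) q);
         lq = lifted_qo G \<Gamma> leq v Q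
     in
       valuation G \<Gamma> leq {\<one>\<^bsub>G\<^esub>} v \<and>
       (\<forall>\<gamma>\<in>\<Gamma>.
          subgroup (U \<gamma>) G \<and> strictly_convex G q (U \<gamma>) \<and>
          subgroup (L \<gamma>) G \<and> strictly_convex G q (L \<gamma>)) \<and>
       (\<forall>\<gamma>\<in>\<Gamma>.
          L \<gamma> \<lhd> G\<lparr>carrier := U \<gamma>\<rparr> \<and>
          (\<forall>g\<in>U \<gamma>. \<forall>h\<in>U \<gamma>.
             Q \<gamma> (L \<gamma> #>\<^bsub>G\<^esub> g) (L \<gamma> #>\<^bsub>G\<^esub> h) \<longleftrightarrow> g \<in> L \<gamma> \<or> (h \<notin> L \<gamma> \<and> q g h)) \<and>
          elementary_type (H \<gamma>) (Q \<gamma>)) \<and>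
       (\<forall>\<gamma>\<in>\<Gamma>. \<forall>\<delta>\<in>\<Gamma>.
          qless leq \<gamma> \<delta> \<and> valuational (H \<gamma>) (Q \<gamma>) \<and> valuational (H \<delta>) (Q \<delta>) \<longrightarrow>
          (\<exists>\<alpha>\<in>\<Gamma>. qless leq \<gamma> \<alpha> \<and> qless leq \<alpha> \<delta> \<and> order_type (H \<alpha>) (Q \<alpha>))) \<and>
       c_quasi_ordered_group G lq \<and>
       (\<exists>W. (\<forall>g\<in>W. weldable G lq g) \<and>
          (\<forall>g\<in>carrier G. \<forall>h\<in>carrier G. q g h \<longleftrightarrow> weld G lq W g h))"
proof -
  interpret cqo_group G q by (rule cqo_group_if_c_quasi_ordered_group) fact
  let ?leq = "type_le_rev q" and ?v = "type_component G q"
  let ?U = "val_ge G ?leq ?v" and ?L = "val_gt G ?leq ?v"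
  have rep: thesis
    if "\<gamma> \<in> type_values G q"
      "\<And>g. \<lbrakk>g \<in> carrier G; g \<noteq> \<one>\<^bsub>G\<^esub>; \<gamma> = ?v g; ?U \<gamma> = up g; ?L \<gamma> = down g\<rbrakk> \<Longrightarrow> thesis" for \<gamma> thesis
    using that val_ge_eq_up val_gt_eq_down by (auto simp: type_values_def)
  have i: "subgroup (?U \<gamma>) G \<and> strictly_convex G q (?U \<gamma>) \<and>
      subgroup (?L \<gamma>) G \<and> strictly_convex G q (?L \<gamma>)" if \<gamma>: "\<gamma> \<in> type_values G q" for \<gamma>
  proof (rule rep[OF \<gamma>])
    fix g assume g: "g \<in> carrier G" "g \<noteq> \<one>\<^bsub>G\<^esub>" and eq: "?U \<gamma> = up g" "?L \<gamma> = down g"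
    have "strictly_convex G q (up g)"
      by (rule strictly_convex_if_comp_downward[OF _ up_downward[OF g(1)]]) (auto simp: up_def)
    moreover have "strictly_convex G q (down g)"
      by (rule strictly_convex_if_comp_downward[OF _ down_downward[OF g(1)]]) (auto simp: down_def)
    ultimately show ?thesis using subgroup_up subgroup_down g by (simp add: eq)
  qed
  have ii: "?L \<gamma> \<lhd> G\<lparr>carrier := ?U \<gamma>\<rparr> \<and>
      (\<forall>g\<in>?U \<gamma>. \<forall>h\<in>?U \<gamma>.
         induced_qo (?L \<gamma>) q (?L \<gamma> #>\<^bsub>G\<^esub> g) (?L \<gamma> #>\<^bsub>G\<^esub> h) \<longleftrightarrow> g \<in> ?L \<gamma> \<or> (h \<notin> ?L \<gamma> \<and> q g h)) \<and>
      elementary_type (G\<lparr>carrier := ?U \<gamma>\<rparr> Mod ?L \<gamma>) (induced_qo (?L \<gamma>) q)"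
    if \<gamma>: "\<gamma> \<in> type_values G q" for \<gamma>
  proof (rule rep[OF \<gamma>])
    fix g assume g: "g \<in> carrier G" "g \<noteq> \<one>\<^bsub>G\<^esub>" and eq: "?U \<gamma> = up g" "?L \<gamma> = down g"
    show ?thesis
      unfolding eq using down_normal[OF g] induced_qo_coset_iff[OF g] elementary_type_quotient[OF g]
      by blast
  qed
  have iii: "\<exists>\<alpha>\<in>type_values G q. qless ?leq \<gamma> \<alpha> \<and> qless ?leq \<alpha> \<delta> \<and>
      order_type (G\<lparr>carrier := ?U \<alpha>\<rparr> Mod ?L \<alpha>) (induced_qo (?L \<alpha>) q)"
    if \<gamma>: "\<gamma> \<in> type_values G q" and \<delta>: "\<delta> \<in> type_values G q" and less: "qless ?leq \<gamma> \<delta>"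
      and val: "valuational (G\<lparr>carrier := ?U \<gamma>\<rparr> Mod ?L \<gamma>) (induced_qo (?L \<gamma>) q)"
        "valuational (G\<lparr>carrier := ?U \<delta>\<rparr> Mod ?L \<delta>) (induced_qo (?L \<delta>) q)"
    for \<gamma> \<delta>
  proof -
    obtain g where g: "g \<in> carrier G" "g \<noteq> \<one>\<^bsub>G\<^esub>" "\<gamma> = ?v g" "?U \<gamma> = up g" "?L \<gamma> = down g"
      using rep[OF \<gamma>] by blast
    obtain h where h: "h \<in> carrier G" "h \<noteq> \<one>\<^bsub>G\<^esub>" "\<delta> = ?v h" "?U \<delta> = up h" "?L \<delta> = down h"
      using rep[OF \<delta>] by blast
    have "\<not> pos (crest g)" using val(1) valuational_quotient_iff[OF g(1,2)] g(4,5) by simp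
    moreover have "\<not> pos (crest h)" using val(2) valuational_quotient_iff[OF h(1,2)] h(4,5) by simp
    \<comment> \<open>Larger values belong to smaller components, so \<open>h\<close> is the one
      below.\<close>
    moreover have "comp_less h g" using less g(3) h(3) qless_type_le_rev_iff[OF h(1) g(1)] by simp
    ultimately obtain k where k: "k \<in> carrier G" "k \<noteq> \<one>\<^bsub>G\<^esub>" "pos (crest k)"
      "comp_less h k" "comp_less k g"
      using comp_less_pos_between g(1) h(1,2) by blast
    have "?v k \<in> type_values G q" using k by (simp add: type_values_def)
    moreover have "qless ?leq \<gamma> (?v k)" "qless ?leq (?v k) \<delta>"
      using k g(1,3) h(1,3) qless_type_le_rev_iff by auto
    moreover have "order_type (G\<lparr>carrier := ?U (?v k)\<rparr> Mod ?L (?v k)) (induced_qo (?L (?v k)) q)"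
      using order_type_quotient_if[OF k(1-3)] val_ge_eq_up[OF k(1)] val_gt_eq_down[OF k(1)] by simp
    ultimately show ?thesis by blast
  qed
  have lift: "c_quasi_ordered_group G lift"
    using c_quasi_ordered_group_if_cqo_group[OF lift_cqo_group] by blast
  \<comment> \<open>The witness for \<open>W\<close> is \<open>weld_points\<close>.\<close>
  have weld: "\<exists>W. (\<forall>g\<in>W. weldable G lift g) \<and>
      (\<forall>g\<in>carrier G. \<forall>h\<in>carrier G. q g h \<longleftrightarrow> weld G lift W g h)"
    using weldable_weld_points weld_lift_iff by blast
  show ?thesis
    unfolding Let_def
    by (intro conjI ballI impI valuation_type_component lift weld) (use i ii iii in blast)+
qed

end
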